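(* Let $X \subset \mathbb{R}\mathbb{P}^n$ be an irreducible nondegenerate real projective variety whose real points are Zariski dense. Let $r_0$ be the minimum typical rank with respect to $X$ and let $r_{\mathrm{gen}}$ be the generic rank with respect to the complexification $X_{\mathbb{C}} = X \otimes \mathbb{C} \subset \mathbb{C}\mathbb{P}^n$. Then $$r_0 = r_{\mathrm{gen}}.$$
   Context: For a field $\mathbb{F}$ (here $\mathbb{R}$ or $\mathbb{C}$) and a projective variety $Y \subset \mathbb{F}\mathbb{P}^n$, let $\hat{Y} \subset \mathbb{F}^{n+1}$ be the affine cone over $Y$ (for a real variety, $\hat Y$ consists of the real vectors in $\mathbb{R}^{n+1}$ lying on the cone). $Y$ is nondegenerate if it is not contained in a hyperplane. For nonzero $v \in \mathbb{F}^{n+1}$, the rank of $v$ with respect to $Y$ is the least $r$ such that $v = x_1 + \dotsb + x_r$ with all $x_i \in \hat Y$. For the real variety $X$, "real points are Zariski dense" means that $X$ is the Zariski closure of its set of real points (equivalently, $X$ has a smooth real point). The complexification $X_{\mathbb{C}} = X \otimes \mathbb{C}$ is the variety in $\mathbb{C}\mathbb{P}^n$ defined by the same equations that define $X$. An integer $r$ is a typical rank with respect to $X$ if the set of vectors in $\mathbb{R}^{n+1}$ whose rank with respect to $X$ equals $r$ contains a nonempty open subset of $\mathbb{R}^{n+1}$ in the Euclidean topology. The generic rank with respect to $X_{\mathbb{C}}$ is the unique $r$ such that the set of vectors in $\mathbb{C}^{n+1}$ whose rank with respect to $X_{\mathbb{C}}$ equals $r$ contains a nonempty Zariski open subset of $\mathbb{C}^{n+1}$.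 *)

theory Defs
  imports "HOL-Analysis.Analysis" "HOL-Library.Poly_Mapping"
begin

text \<open>
  Coordinates are indexed by a finite type \<open>'n\<close>, so projective \<open>n\<close>-space has
  homogeneous coordinates in \<open>'a ^ 'n\<close> with \<open>CARD('n) = n + 1\<close>. A polynomial is a finitely
  supported map from exponent vectors to coefficients.
\<close>

type_synonym ('a, 'n) mpoly = "('n \<Rightarrow>\<^sub>0 nat) \<Rightarrow>\<^sub>0 'a"

definition eval_mpoly :: "('a::field, 'n::finite) mpoly \<Rightarrow> 'a ^ 'n \<Rightarrow> 'a" where
  "eval_mpoly p x =
     (\<Sum>m\<in>Poly_Mapping.keys p. Poly_Mapping.lookup p m * (\<Prod>i\<in>UNIV. x $ i ^ Poly_Mapping.lookup m i))"

definition homogeneous :: "('a::field, 'n::finite) mpoly \<Rightarrow> bool" where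
  "homogeneous p \<longleftrightarrow> (\<exists>d. \<forall>m\<in>Poly_Mapping.keys p. (\<Sum>i\<in>UNIV. Poly_Mapping.lookup m i) = d)"

definition zariski_open :: "('a::field ^ 'n::finite) set \<Rightarrow> bool" where
  "zariski_open U \<longleftrightarrow>
     (\<exists>S :: ('a, 'n) mpoly set. U = {x. \<exists>p\<in>S. eval_mpoly p x \<noteq> 0})"


text \<open>A point of projective space is a line through the origin of \<open>'a ^ 'n\<close>.\<close>

definition proj_point :: "'a::field ^ 'n::finite \<Rightarrow> ('a ^ 'n) set" where
  "proj_point v = range (\<lambda>c. c *s v)"

definition proj_zeros :: "('a::field, 'n::finite) mpoly set \<Rightarrow> ('a ^ 'n) set set" where
  "proj_zeros E = {proj_point v | v. v \<noteq> 0 \<and> (\<forall>p\<in>E. eval_mpoly p v = 0)}"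

definition hyperplane :: "'a::field ^ 'n::finite \<Rightarrow> ('a ^ 'n) set set" where
  "hyperplane a = {proj_point v | v. v \<noteq> 0 \<and> (\<Sum>i\<in>UNIV. a $ i * v $ i) = 0}"

definition affine_cone :: "('a::field ^ 'n::finite) set set \<Rightarrow> ('a ^ 'n) set" where
  "affine_cone Y = insert 0 (\<Union>Y)"


definition has_rank :: "('a::field ^ 'n::finite) set set \<Rightarrow> 'a ^ 'n \<Rightarrow> nat \<Rightarrow> bool" where
  "has_rank Y v r \<longleftrightarrow> v \<noteq> 0 \<and>
     (\<exists>x. (\<forall>i<r. x i \<in> affine_cone Y) \<and> v = (\<Sum>i<r. x i)) \<and>
     (\<forall>s<r. \<not> (\<exists>x. (\<forall>i<s. x i \<in> affine_cone Y) \<and> v = (\<Sum>i<s. x i)))"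

definition typical_rank :: "(real ^ 'n::finite) set set \<Rightarrow> nat \<Rightarrow> bool" where
  "typical_rank Y r \<longleftrightarrow> (\<exists>U. open U \<and> U \<noteq> {} \<and> U \<subseteq> {v. has_rank Y v r})"

definition min_typical_rank :: "(real ^ 'n::finite) set set \<Rightarrow> nat \<Rightarrow> bool" where
  "min_typical_rank Y r \<longleftrightarrow> typical_rank Y r \<and> (\<forall>s. typical_rank Y s \<longrightarrow> r \<le> s)"

definition generic_rank :: "(complex ^ 'n::finite) set set \<Rightarrow> nat \<Rightarrow> bool" where
  "generic_rank Y r \<longleftrightarrow> (\<exists>U. zariski_open U \<and> U \<noteq> {} \<and> U \<subseteq> {v. has_rank Y v r})"


text \<open>
  A real projective variety \<open>X\<close> is presented by a set \<open>E\<close> of real homogeneous polynomials.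
  Its real points are \<^term>\<open>proj_zeros E\<close> and its complexification is the complex zero set of
  the same equations. The real points may be too few to determine \<open>X\<close>, so \<open>X\<close> itself
  is represented by its complex points: a subvariety defined over \<open>\<real>\<close> is a subset of
  complex projective space cut out by real homogeneous equations. By the Nullstellensatz these
  sets correspond to the radical homogeneous ideals of the real polynomial ring (with the
  irrelevant ideal and the unit ideal both giving the empty set), i.e. to the
  closed subsets of the scheme-theoretic real projective space.
\<close>

definition complex_vec :: "real ^ 'n::finite \<Rightarrow> complex ^ 'n" where
  "complex_vec v = (\<chi> i. complex_of_real (v $ i))"

definition complexification :: "(real, 'n::finite) mpoly set \<Rightarrow> (complex ^ 'n) set set" where
  "complexification E = proj_zeros (Poly_Mapping.map complex_of_real ` E)"

definition real_zariski_closed :: "(complex ^ 'n::finite) set set \<Rightarrow> bool" where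
  "real_zariski_closed Z \<longleftrightarrow> (\<exists>E. (\<forall>p\<in>E. homogeneous p) \<and> Z = complexification E)"

definition real_zariski_closure :: "(complex ^ 'n::finite) set set \<Rightarrow> (complex ^ 'n) set set" where
  "real_zariski_closure P = \<Inter>{Z. real_zariski_closed Z \<and> P \<subseteq> Z}"

text \<open>Irreducibility is over \<open>\<real>\<close>: only pieces defined over \<open>\<real>\<close> are considered.\<close>

definition irreducible_variety :: "(real, 'n::finite) mpoly set \<Rightarrow> bool" where
  "irreducible_variety E \<longleftrightarrow> complexification E \<noteq> {} \<and>
     (\<forall>A B. real_zariski_closed A \<and> real_zariski_closed B \<and> complexification E = A \<union> B
        \<longrightarrow> complexification E = A \<or> complexification E = B)"

definition nondegenerate :: "(real, 'n::finite) mpoly set \<Rightarrow> bool" where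
  "nondegenerate E \<longleftrightarrow>
     (\<forall>a. a \<noteq> 0 \<longrightarrow> \<not> complexification E \<subseteq> hyperplane (complex_vec a))"

text \<open>Real points are regarded as points of complex projective space by extending scalars.\<close>

definition real_points_dense :: "(real, 'n::finite) mpoly set \<Rightarrow> bool" where
  "real_points_dense E \<longleftrightarrow>
     complexification E =
       real_zariski_closure {proj_point (complex_vec v) | v. v \<noteq> 0 \<and> proj_point v \<in> proj_zeros E}"


text \<open>Any two nonempty Zariski open sets meet, so there is at most one generic rank.\<close>

lemma eval_mpoly_on_line:
  "\<exists>P. \<forall>t. poly P t = eval_mpoly p (x + t *s (y - x))" for x y :: "'a::field ^ 'n::finite"
proof (intro exI allI)
  fix t
  show "poly (\<Sum>m\<in>Poly_Mapping.keys p. [:Poly_Mapping.lookup p m:] *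
      (\<Prod>i\<in>UNIV. [:x $ i, y $ i - x $ i:] ^ Poly_Mapping.lookup m i)) t
    = eval_mpoly p (x + t *s (y - x))"
    by (simp add: eval_mpoly_def poly_sum poly_prod right_diff_distrib)
qed

lemma zariski_open_meet:
  fixes U V :: "(complex ^ 'n::finite) set"
  assumes "zariski_open U" "U \<noteq> {}" "zariski_open V" "V \<noteq> {}"
  shows "U \<inter> V \<noteq> {}"
proof -
  obtain S T where U: "U = {x. \<exists>p\<in>S. eval_mpoly p x \<noteq> 0}"
    and V: "V = {x. \<exists>p\<in>T. eval_mpoly p x \<noteq> 0}"
    using assms by (auto simp: zariski_open_def)
  obtain p x where p: "p \<in> S" "eval_mpoly p x \<noteq> 0" using assms U by blast
  obtain q y where q: "q \<in> T" "eval_mpoly q y \<noteq> 0" using assms V by blast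
  obtain P where P: "\<And>t. poly P t = eval_mpoly p (x + t *s (y - x))"
    using eval_mpoly_on_line by metis
  obtain Q where Q: "\<And>t. poly Q t = eval_mpoly q (x + t *s (y - x))"
    using eval_mpoly_on_line by metis
  have "poly P 0 \<noteq> 0" "poly Q 1 \<noteq> 0" using p q by (simp_all add: P Q)
  then have "P * Q \<noteq> 0" by auto
  then have "finite {t. poly (P * Q) t = 0}" by (rule poly_roots_finite)
  then obtain t where "poly (P * Q) t \<noteq> 0"
    using ex_new_if_finite[OF infinite_UNIV_char_0] by blast
  then have "x + t *s (y - x) \<in> U \<inter> V" using p q by (auto simp: U V P Q)
  then show ?thesis by blast
qed

lemma generic_rank_unique:
  assumes "generic_rank Y r" "generic_rank Y s"
  shows "r = s"
proof -
  obtain v where v: "has_rank Y v r" "has_rank Y v s"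
    using assms zariski_open_meet unfolding generic_rank_def by blast
  from v have "\<not> r < s" unfolding has_rank_def by blast
  moreover from v have "\<not> s < r" unfolding has_rank_def by blast
  ultimately show ?thesis by simp
qed

end

theory Submission
  imports Defs
begin

text \<open>
  A Zariski open set of complex vectors meets every Euclidean open set of real vectors, and a real
  decomposition is also a complex one, so the generic rank is at most every typical rank.

  Conversely, let \<open>S r\<close> be the set of sums of \<open>r\<close> real vectors of the cone. If a nonzero
  polynomial vanishes on \<open>S r\<close>, then by density of the real points it vanishes on
  all sums of \<open>r\<close> complex vectors of the cone; so this fails for the generic rank. Take the least
  \<open>r\<close> for which it fails. Then \<open>S r\<close> contains an open set \<open>U\<close>, and \<open>U\<close> minus a hypersurface
  containing \<open>S (r - 1)\<close> consists of vectors of rank exactly \<open>r\<close>.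

  That \<open>S r\<close> contains an open set is shown by eliminating one variable at a time from the
  graph of the summation map, an irreducible real algebraic set \<open>V\<close>. If a variable is algebraic over
  the previous ones on \<open>V\<close>, take a relation of minimal degree in it. At a point where neither its
  leading coefficient nor its derivative vanishes, it has a simple root, which persists nearby by the
  intermediate value theorem; pseudo-division shows that the perturbed root satisfies
  all equations of \<open>V\<close> that involve no further variables.
\<close>

section \<open>Polynomial functions\<close>

text \<open>Polynomials are treated as functions here, so that substitution and change of index type
  are immediate. The set \<open>A\<close> records which variables may occur; the index type itself
  may be infinite.\<close>

inductive_set poly_funs :: "'i set \<Rightarrow> (('i \<Rightarrow> 'a::comm_ring_1) \<Rightarrow> 'a) set" for A where
  const: "(\<lambda>_. c) \<in> poly_funs A"
| coord: "a \<in> A \<Longrightarrow> (\<lambda>x. x a) \<in> poly_funs A"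
| add: "f \<in> poly_funs A \<Longrightarrow> g \<in> poly_funs A \<Longrightarrow> (\<lambda>x. f x + g x) \<in> poly_funs A"
| mult: "f \<in> poly_funs A \<Longrightarrow> g \<in> poly_funs A \<Longrightarrow> (\<lambda>x. f x * g x) \<in> poly_funs A"

lemma poly_funs_subst:
  assumes "f \<in> poly_funs A" "\<And>a. a \<in> A \<Longrightarrow> (\<lambda>x. s x a) \<in> poly_funs B"
  shows "(\<lambda>x. f (s x)) \<in> poly_funs B"
  using assms(1) by induction (auto intro: poly_funs.intros assms(2))

lemma poly_funs_mono: "f \<in> poly_funs A \<Longrightarrow> A \<subseteq> B \<Longrightarrow> f \<in> poly_funs B"
  using poly_funs_subst[of f A "\<lambda>x. x" B] by (auto intro: poly_funs.coord)

lemma poly_funs_cong: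
  assumes "f \<in> poly_funs A" "\<And>a. a \<in> A \<Longrightarrow> x a = y a"
  shows "f x = f y"
  using assms(1) by induction (auto simp: assms(2))

lemma poly_funs_sum:
  "(\<And>i. i \<in> I \<Longrightarrow> f i \<in> poly_funs A) \<Longrightarrow> (\<lambda>x. \<Sum>i\<in>I. f i x) \<in> poly_funs A"
  by (induction I rule: infinite_finite_induct) (auto intro: poly_funs.intros)

lemma poly_funs_power: "f \<in> poly_funs A \<Longrightarrow> (\<lambda>x. f x ^ k) \<in> poly_funs A"
  by (induction k) (auto intro: poly_funs.intros)

lemma poly_funs_prod:
  "(\<And>i. i \<in> I \<Longrightarrow> f i \<in> poly_funs A) \<Longrightarrow> (\<lambda>x. \<Prod>i\<in>I. f i x) \<in> poly_funs A"
  by (induction I rule: infinite_finite_induct) (auto intro: poly_funs.intros)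

lemma poly_funs_minus: "f \<in> poly_funs A \<Longrightarrow> (\<lambda>x. - f x) \<in> poly_funs A"
  using poly_funs.mult[OF poly_funs.const[of "-1"]] by fastforce

lemma poly_funs_diff:
  "f \<in> poly_funs A \<Longrightarrow> g \<in> poly_funs A \<Longrightarrow> (\<lambda>x. f x - g x) \<in> poly_funs A"
  using poly_funs.add[OF _ poly_funs_minus] by fastforce

text \<open>Continuity at \<open>p\<close> measured on the coordinates in \<open>A\<close> alone:
  the other coordinates of \<open>q\<close> may be arbitrary, since \<open>f\<close> does not see
  them.\<close>

lemma poly_funs_eventually_close:
  fixes f :: "('i \<Rightarrow> real) \<Rightarrow> real"
  assumes "f \<in> poly_funs A" "e > 0"
  shows "\<exists>d>0. \<forall>q. (\<forall>a\<in>A. \<bar>q a - p a\<bar> < d) \<longrightarrow> \<bar>f q - f p\<bar> < e"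
proof -
  \<comment> \<open>The filter of sets of points uniformly close to \<open>p\<close> on
    \<open>A\<close>. It makes the limit rules for sums and products available without a topology on
    the points.\<close>
  define F where "F = (INF d\<in>{0<..}. principal {q. \<forall>a\<in>A. \<bar>q a - p a\<bar> < (d::real)})"
  have ev: "eventually P F \<longleftrightarrow> (\<exists>d>0. \<forall>q. (\<forall>a\<in>A. \<bar>q a - p a\<bar> < d) \<longrightarrow> P q)" for P
    unfolding F_def
    by (subst eventually_INF_base)
       (auto simp: eventually_principal intro!: bexI[of _ "min _ _"])
  have "(f \<longlongrightarrow> f p) F"
    using assms(1)
  proof induction
    case (coord a)
    show ?case
      unfolding tendsto_iff dist_real_def ev using coord by blast
  qed (auto intro: tendsto_intros)
  from tendstoD[OF this assms(2)] show ?thesis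
    unfolding dist_real_def ev .
qed

text \<open>Singles out the variable \<open>b\<close> to be eliminated. The number \<open>d\<close>
  only bounds the degree in \<open>b\<close>, as leading coefficients may vanish.\<close>

lemma poly_funs_expand:
  fixes f :: "('i \<Rightarrow> 'a::comm_ring_1) \<Rightarrow> 'a"
  assumes "f \<in> poly_funs (insert b C)"
  shows "\<exists>d c. (\<forall>j. c j \<in> poly_funs C) \<and> f = (\<lambda>x. \<Sum>j\<le>d. c j x * x b ^ j)"
proof -
  define Q where "Q = {f :: ('i \<Rightarrow> 'a) \<Rightarrow> 'a. \<exists>d c. (\<forall>j. c j \<in> poly_funs C) \<and> (\<forall>x. f x = (\<Sum>j\<le>d::nat. c j x * x b ^ j))}"
  have mono: "(\<lambda>x. c x * x b ^ k) \<in> Q" if "c \<in> poly_funs C" for c k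
    unfolding Q_def
    using that by (auto intro!: exI[of _ k] exI[of _ "\<lambda>j. if j = k then c else (\<lambda>_. 0)"] poly_funs.const
        simp: if_distrib[of "\<lambda>f. f _ * _"] cong: if_cong)
  have add: "(\<lambda>x. f x + g x) \<in> Q" if "f \<in> Q" "g \<in> Q" for f g
  proof -
    from that obtain d c e c' where c: "\<And>j. c j \<in> poly_funs C" "\<And>x. f x = (\<Sum>j\<le>d. c j x * x b ^ j)"
      and c': "\<And>j. c' j \<in> poly_funs C" "\<And>x. g x = (\<Sum>j\<le>e. c' j x * x b ^ j)"
      unfolding Q_def by blast
    define a where "a j = (\<lambda>x. (if j \<le> d then c j else (\<lambda>_. 0)) x + (if j \<le> e then c' j else (\<lambda>_. 0)) x)" for j
    have "a j \<in> poly_funs C" for j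
      unfolding a_def by (intro poly_funs.add) (auto intro: c c' poly_funs.const)
    moreover have "f x + g x = (\<Sum>j\<le>max d e. a j x * x b ^ j)" for x
    proof -
      have "f x = (\<Sum>j\<le>max d e. (if j \<le> d then c j else (\<lambda>_. 0)) x * x b ^ j)"
        unfolding c by (rule sum.mono_neutral_cong_left) auto
      moreover have "g x = (\<Sum>j\<le>max d e. (if j \<le> e then c' j else (\<lambda>_. 0)) x * x b ^ j)"
        unfolding c' by (rule sum.mono_neutral_cong_left) auto
      ultimately show ?thesis
        unfolding a_def by (simp add: distrib_right sum.distrib)
    qed
    ultimately show ?thesis unfolding Q_def by blast
  qed
  have zero: "(\<lambda>x. 0) \<in> Q"
    using mono[OF poly_funs.const[of 0]] by simp
  have sum: "(\<lambda>x. \<Sum>i\<in>I. h i x) \<in> Q" if "\<And>i. i \<in> I \<Longrightarrow> h i \<in> Q" for I and h :: "nat \<Rightarrow> _"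
    using that by (induction I rule: infinite_finite_induct) (auto intro: add zero)
  have "f \<in> Q"
    using assms
  proof induction
    case (const c)
    show ?case using mono[OF poly_funs.const, of c 0] by simp
  next
    case (coord a)
    show ?case
    proof (cases "a = b")
      case True
      then show ?thesis using mono[OF poly_funs.const, of 1 1] by simp
    next
      case False
      then show ?thesis using mono[OF poly_funs.coord, of a 0] coord by simp
    qed
  next
    case (add f g)
    then show ?case using \<open>\<And>f g. f \<in> Q \<Longrightarrow> g \<in> Q \<Longrightarrow> _\<close> by blast
  next
    case (mult f g)
    then obtain d c e c' where c: "\<And>j. c j \<in> poly_funs C" "\<And>x. f x = (\<Sum>j\<le>d. c j x * x b ^ j)"
      and c': "\<And>j. c' j \<in> poly_funs C" "\<And>x. g x = (\<Sum>j\<le>e. c' j x * x b ^ j)"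
      unfolding Q_def by blast
    have "(\<lambda>x. \<Sum>i\<le>d. \<Sum>j\<le>e. (c i x * c' j x) * x b ^ (i + j)) \<in> Q"
      by (intro sum mono poly_funs.mult c c')
    moreover have "(\<lambda>x. f x * g x) = (\<lambda>x. \<Sum>i\<le>d. \<Sum>j\<le>e. (c i x * c' j x) * x b ^ (i + j))"
      by (rule ext) (simp only: c c' sum_product, simp add: power_add mult_ac)
    ultimately show ?case by simp
  qed
  then show ?thesis unfolding Q_def by (auto simp: fun_eq_iff)
qed

lemma poly_funs_univariate:
  fixes f :: "('i \<Rightarrow> 'a::field) \<Rightarrow> 'a"
  assumes "f \<in> poly_funs A"
  shows "\<exists>P. \<forall>t. poly P t = f (x(i := t))"
  using assms
proof induction
  case (const c)
  show ?case by (rule exI[of _ "[:c:]"]) simp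
next
  case (coord a)
  show ?case by (rule exI[of _ "if a = i then [:0, 1:] else [:x a:]"]) simp
next
  case (add f g)
  then obtain P Q where "\<forall>t. poly P t = f (x(i := t))" "\<forall>t. poly Q t = g (x(i := t))" by blast
  then show ?case by (intro exI[of _ "P + Q"]) (simp del: fun_upd_apply)
next
  case (mult f g)
  then obtain P Q where "\<forall>t. poly P t = f (x(i := t))" "\<forall>t. poly Q t = g (x(i := t))" by blast
  then show ?case by (intro exI[of _ "P * Q"]) (simp del: fun_upd_apply)
qed

text \<open>The coordinates of \<open>z\<close> are moved into the sets \<open>T i\<close> one at a
  time. In each coordinate \<open>f\<close> is a nonzero univariate polynomial, whose finitely many
  roots cannot exhaust \<open>T i\<close>.\<close>

lemma poly_funs_nonzero_on_grid:
  fixes f :: "('i::finite \<Rightarrow> 'a::field) \<Rightarrow> 'a"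
  assumes f: "f \<in> poly_funs UNIV" "f z \<noteq> 0" and T: "\<And>i. infinite (T i)"
  shows "\<exists>x. (\<forall>i. x i \<in> T i) \<and> f x \<noteq> 0"
proof -
  have "\<exists>x. (\<forall>i\<in>I. x i \<in> T i) \<and> f x \<noteq> 0" if "finite I" for I
    using that
  proof (induction I)
    case empty
    show ?case using f by auto
  next
    case (insert i I)
    then obtain x where x: "\<forall>i\<in>I. x i \<in> T i" "f x \<noteq> 0" by blast
    obtain P where P: "\<And>t. poly P t = f (x(i := t))"
      using poly_funs_univariate[OF f(1)] by metis
    from P[of "x i"] x(2) have "P \<noteq> 0" by auto
    then have "finite {t. poly P t = 0}" by (rule poly_roots_finite)
    then obtain t where "t \<in> T i" "poly P t \<noteq> 0"
      using T[of i] by (metis (mono_tags, lifting) finite_subset mem_Collect_eq subsetI)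
    then have "f (x(i := t)) \<noteq> 0" by (simp only: P not_False_eq_True)
    moreover have "\<forall>j\<in>insert i I. (x(i := t)) j \<in> T j" using x \<open>t \<in> T i\<close> by auto
    ultimately show ?case by blast
  qed
  from this[of UNIV] show ?thesis by auto
qed

section \<open>Projections of irreducible real algebraic sets\<close>

text \<open>Two nonempty relatively open subsets of \<open>V\<close> meet; equivalently, the
  polynomials vanishing on \<open>V\<close> form a prime ideal.\<close>

definition zariski_irreducible :: "('i \<Rightarrow> 'a::comm_ring_1) set \<Rightarrow> bool" where
  "zariski_irreducible V \<longleftrightarrow> V \<noteq> {} \<and>
     (\<forall>f\<in>poly_funs UNIV. \<forall>g\<in>poly_funs UNIV. \<forall>x\<in>V. \<forall>y\<in>V.
        f x \<noteq> 0 \<longrightarrow> g y \<noteq> 0 \<longrightarrow> (\<exists>z\<in>V. f z \<noteq> 0 \<and> g z \<noteq> 0))"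

lemma zariski_irreducibleD:
  assumes "zariski_irreducible V" "f \<in> poly_funs UNIV" "g \<in> poly_funs UNIV"
    "x \<in> V" "y \<in> V" "f x \<noteq> 0" "g y \<noteq> 0"
  shows "\<exists>z\<in>V. f z \<noteq> 0 \<and> g z \<noteq> 0"
  using assms unfolding zariski_irreducible_def by blast

text \<open>The cylinder over the Zariski closure of the projection of \<open>V\<close> to the coordinates in \<open>A\<close>.\<close>

definition cylinder_closure :: "'i set \<Rightarrow> ('i \<Rightarrow> 'a::comm_ring_1) set \<Rightarrow> ('i \<Rightarrow> 'a) set" where
  "cylinder_closure A V = {x. \<forall>f\<in>poly_funs A. (\<forall>y\<in>V. f y = 0) \<longrightarrow> f x = 0}"

lemma cylinder_closureD:
  assumes "x \<in> cylinder_closure A V" "f \<in> poly_funs A" "\<forall>y\<in>V. f y = 0"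
  shows "f x = 0"
  using assms unfolding cylinder_closure_def by simp

text \<open>At a simple root the derivative has a sign, so the values on the two sides of the root
  have opposite signs arbitrarily near to it.\<close>

lemma simple_root_sign_change:
  fixes P :: "real poly"
  assumes "poly P t = 0" "poly (pderiv P) t \<noteq> 0" "e > 0"
  obtains s u where "t - e < s" "s < t" "t < u" "u < t + e" "poly P s * poly P u < 0"
proof -
  have D: "(poly P has_real_derivative poly (pderiv P) t) (at t)" by (rule poly_DERIV)
  show ?thesis
  proof (cases "poly (pderiv P) t > 0")
    case True
    from DERIV_pos_inc_right[OF D True] DERIV_pos_inc_left[OF D True] obtain d d' where
      d: "d > 0" "\<And>h. 0 < h \<Longrightarrow> h < d \<Longrightarrow> poly P t < poly P (t + h)"
      "d' > 0" "\<And>h. 0 < h \<Longrightarrow> h < d' \<Longrightarrow> poly P (t - h) < poly P t"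
      by blast
    define h where "h = min (min d d') e / 2"
    have h: "0 < h" "h < d" "h < d'" "h < e" using d(1,3) assms(3) by (auto simp: h_def)
    show ?thesis
      by (rule that[of "t - h" "t + h"])
         (use h d(2)[of h] d(4)[of h] assms(1) in \<open>auto intro: mult_neg_pos\<close>)
  next
    case False
    then have neg: "poly (pderiv P) t < 0" using assms(2) by simp
    from DERIV_neg_dec_right[OF D neg] DERIV_neg_dec_left[OF D neg] obtain d d' where
      d: "d > 0" "\<And>h. 0 < h \<Longrightarrow> h < d \<Longrightarrow> poly P t > poly P (t + h)"
      "d' > 0" "\<And>h. 0 < h \<Longrightarrow> h < d' \<Longrightarrow> poly P (t - h) > poly P t"
      by blast
    define h where "h = min (min d d') e / 2"
    have h: "0 < h" "h < d" "h < d'" "h < e" using d(1,3) assms(3) by (auto simp: h_def)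
    show ?thesis
      by (rule that[of "t - h" "t + h"])
         (use h d(2)[of h] d(4)[of h] assms(1) in \<open>auto intro: mult_pos_neg\<close>)
  qed
qed

text \<open>Either \<open>b\<close> is transcendental over \<open>C\<close> on \<open>V\<close> and
  every value of it is allowed, or off \<open>h = 0\<close> it is a simple root of a minimal
  relation, and a root persists nearby. Closeness of the new coordinate to \<open>p b\<close> is
  what allows further variables to be added afterwards.\<close>

lemma cylinder_closure_projection_open_step:
  fixes V :: "('i \<Rightarrow> real) set"
  assumes irr: "zariski_irreducible V" and "b \<notin> C"
  shows "\<exists>h\<in>poly_funs (insert b C). (\<exists>p\<in>V. h p \<noteq> 0) \<and>
    (\<forall>p\<in>V. h p \<noteq> 0 \<longrightarrow> (\<forall>e>0. \<exists>d>0. \<forall>q\<in>cylinder_closure C V. (\<forall>a\<in>C. \<bar>q a - p a\<bar> < d) \<longrightarrow>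
      (\<exists>t. \<bar>t - p b\<bar> < e \<and> q(b := t) \<in> cylinder_closure (insert b C) V)))"
proof -
  define van where "van f \<longleftrightarrow> (\<forall>y\<in>V. f y = 0)" for f :: "('i \<Rightarrow> real) \<Rightarrow> real"
  define rel where "rel d c \<longleftrightarrow> (\<forall>j. c j \<in> poly_funs C) \<and> van (\<lambda>x. \<Sum>j\<le>d. c j x * x b ^ j)"
    for d :: nat and c
  have upd: "c (q(b := t)) = c q" if "c \<in> poly_funs C" for c q and t :: real
    by (rule poly_funs_cong[OF that]) (use \<open>b \<notin> C\<close> in auto)
  have cyl: "c q = 0" if "q \<in> cylinder_closure C V" "c \<in> poly_funs C" "van c" for c q
    using that unfolding cylinder_closure_def van_def by blast
  show ?thesis
  proof (cases "\<exists>d c. rel d c \<and> (\<exists>j\<le>d. \<not> van (c j))")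
    \<comment> \<open>Every relation for \<open>b\<close> over \<open>C\<close> on \<open>V\<close>
      is trivial, so the equations of the larger closure impose no condition on \<open>b\<close>.
      Any \<open>t\<close> works, in particular \<open>p b\<close>, and \<open>h\<close> is
      constant.\<close>
    case False
    have *: "q(b := t) \<in> cylinder_closure (insert b C) V" if q: "q \<in> cylinder_closure C V" for q t
      unfolding cylinder_closure_def
    proof safe
      fix f assume f: "f \<in> poly_funs (insert b C)" "\<forall>y\<in>V. f y = 0"
      obtain d c where c: "\<And>j. c j \<in> poly_funs C" "f = (\<lambda>x. \<Sum>j\<le>d. c j x * x b ^ j)"
        using poly_funs_expand[OF f(1)] by blast
      have "rel d c" using f(2) c by (auto simp: rel_def van_def)
      then have "van (c j)" if "j \<le> d" for j using False that by blast
      then show "f (q(b := t)) = 0"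
        unfolding c(2) by (intro sum.neutral) (auto simp: upd[OF c(1)] cyl[OF q c(1)])
    qed
    have "\<exists>d>0. \<forall>q\<in>cylinder_closure C V. (\<forall>a\<in>C. \<bar>q a - p a\<bar> < d) \<longrightarrow>
        (\<exists>t. \<bar>t - p b\<bar> < e \<and> q(b := t) \<in> cylinder_closure (insert b C) V)" if "e > 0" for p e
    proof (rule exI[of _ 1], intro conjI ballI impI)
      fix q assume "q \<in> cylinder_closure C V"
      with * that show "\<exists>t. \<bar>t - p b\<bar> < e \<and> q(b := t) \<in> cylinder_closure (insert b C) V"
        by (intro exI[of _ "p b"]) simp
    qed simp
    note open_all = this
    from irr obtain v where "v \<in> V" by (auto simp: zariski_irreducible_def)
    then show ?thesis
      by (intro bexI[of _ "\<lambda>_. 1"] conjI bexI[of _ v] ballI impI allI poly_funs.const open_all) simp_all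
  next
    case True
    \<comment> \<open>Among the relations that have a coefficient not vanishing on \<open>V\<close>,
      one of least formal degree is chosen.\<close>
    define bad where "bad d \<longleftrightarrow> (\<exists>c. rel d c \<and> (\<exists>j\<le>d. \<not> van (c j)))" for d
    define d where "d = (LEAST d. bad d)"
    have "bad d" unfolding d_def using True unfolding bad_def[symmetric] by (rule LeastI_ex)
    then obtain c where c: "rel d c" "\<exists>j\<le>d. \<not> van (c j)" by (auto simp: bad_def)
    have least: "van (c' j)" if "rel e c'" "j \<le> e" "e < d" for e c' j
      using not_less_Least[of e bad] that unfolding d_def bad_def by blast
    have cC: "c j \<in> poly_funs C" for j using c(1) by (simp add: rel_def)
    have vanP: "(\<Sum>j\<le>d. c j x * x b ^ j) = 0" if "x \<in> V" for x
      using c(1) that by (simp add: rel_def van_def)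
    have d0: "d > 0"
    proof (rule ccontr)
      assume "\<not> d > 0"
      with c show False by (auto simp: rel_def)
    qed
    then obtain d' where d': "d = Suc d'" using gr0_implies_Suc by blast
    \<comment> \<open>Otherwise the leading term could be dropped; by minimality the remaining
      coefficients would vanish on \<open>V\<close> as well, and the relation would be
      trivial.\<close>
    have lead: "\<not> van (c d)"
    proof
      assume "van (c d)"
      then have "rel d' c" using c(1) by (auto simp: rel_def van_def d')
      then have "van (c j)" if "j \<le> d'" for j using least[of d' c j] that d' by simp
      with \<open>van (c d)\<close> c(2) d' show False by (auto simp: le_Suc_eq)
    qed
    \<comment> \<open>The formal derivative of the minimal relation with respect to
      \<open>b\<close>. Its formal degree is \<open>d - 1\<close>, so if it vanished on
      \<open>V\<close>, minimality would make its top coefficient, a nonzero multiple of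
      \<open>c d\<close>, vanish there too.\<close>
    define P' where "P' = (\<lambda>x. \<Sum>j\<le>d'. (real (Suc j) * c (Suc j) x) * x b ^ j)"
    have coefs: "(\<lambda>x. real (Suc j) * c (Suc j) x) \<in> poly_funs C" for j
      by (intro poly_funs.mult poly_funs.const cC)
    have "\<not> van P'"
    proof
      assume "van P'"
      then have "rel d' (\<lambda>j x. real (Suc j) * c (Suc j) x)"
        using coefs by (simp add: rel_def P'_def)
      from least[OF this, of d'] lead d' show False by (auto simp: van_def)
    qed
    have P'C: "P' \<in> poly_funs (insert b C)"
      unfolding P'_def
      by (intro poly_funs_sum poly_funs.mult[OF _ poly_funs_power] poly_funs.coord poly_funs_mono[OF coefs]) auto
    have cdC: "c d \<in> poly_funs (insert b C)" by (rule poly_funs_mono[OF cC]) auto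
    define h where "h = (\<lambda>x. c d x * P' x)"
    have hC: "h \<in> poly_funs (insert b C)" unfolding h_def by (intro poly_funs.mult cdC P'C)
    have "\<exists>p\<in>V. h p \<noteq> 0"
    proof -
      have "c d \<in> poly_funs UNIV" "P' \<in> poly_funs UNIV"
        using cdC P'C by (auto intro: poly_funs_mono)
      then show ?thesis
        using irr lead \<open>\<not> van P'\<close> unfolding zariski_irreducible_def van_def h_def
        by (metis mult_eq_0_iff)
    qed
    \<comment> \<open>Pseudo-division by the minimal relation lowers the formal degree of any other
      relation until it is below \<open>d\<close>. There all coefficients vanish on
      \<open>V\<close>, hence on the closure over \<open>C\<close>.\<close>
    have division: "(\<Sum>j\<le>e. c' j x * x b ^ j) = 0"
      if "rel e c'" "x \<in> cylinder_closure C V" "(\<Sum>j\<le>d. c j x * x b ^ j) = 0" "c d x \<noteq> 0" for e c' x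
      using that(1)
    proof (induction e arbitrary: c' rule: less_induct)
      case (less e)
      then have c': "c' j \<in> poly_funs C" for j by (simp add: rel_def)
      show ?case
      proof (cases "e < d")
        case True
        have "c' j x = 0" if "j \<le> e" for j
          using cyl[OF \<open>x \<in> _\<close> c'] least[OF less.prems that True] by blast
        then show ?thesis by simp
      next
        case False
        then obtain e' where e': "e = Suc e'" using d0 by (cases e) auto
        \<comment> \<open>The coefficients of \<open>c d\<close> times the given relation minus
          \<open>c' e * x b ^ (e - d)\<close> times the minimal one. The top one cancels, so the sum
          may stop at \<open>e' = e - 1\<close>. The case \<open>j < e - d\<close> is separated
          because subtraction of naturals truncates.\<close>
        define a where "a j = (\<lambda>x. c d x * c' j x - (if j < e - d then (\<lambda>_. 0) else (\<lambda>x. c' e x * c (j - (e - d)) x)) x)" for j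
        have aC: "a j \<in> poly_funs C" for j
          unfolding a_def by (intro poly_funs_diff poly_funs.mult) (auto intro: cC c' poly_funs.const poly_funs.mult)
        have eq: "(\<Sum>j\<le>e'. a j y * y b ^ j) =
            c d y * (\<Sum>j\<le>e. c' j y * y b ^ j) - c' e y * y b ^ (e - d) * (\<Sum>j\<le>d. c j y * y b ^ j)" for y
        proof -
          have "(\<Sum>j\<le>e'. a j y * y b ^ j) = (\<Sum>j\<le>e. a j y * y b ^ j)"
            using False by (simp add: e' a_def)
          also have "\<dots> = c d y * (\<Sum>j\<le>e. c' j y * y b ^ j) -
              (\<Sum>j\<le>e. (if j < e - d then 0 else c' e y * c (j - (e - d)) y) * y b ^ j)"
            by (simp only: a_def if_distribR left_diff_distrib sum_subtractf sum_distrib_left mult.assoc)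
          also have "(\<Sum>j\<le>e. (if j < e - d then 0 else c' e y * c (j - (e - d)) y) * y b ^ j) =
              (\<Sum>j\<in>{e - d..e}. c' e y * c (j - (e - d)) y * y b ^ j)"
            by (rule sum.mono_neutral_cong_right) auto
          also have "\<dots> = (\<Sum>j\<le>d. c' e y * c j y * y b ^ (j + (e - d)))"
            using False by (intro sum.reindex_bij_witness[of _ "\<lambda>j. j + (e - d)" "\<lambda>j. j - (e - d)"]) auto
          also have "\<dots> = c' e y * y b ^ (e - d) * (\<Sum>j\<le>d. c j y * y b ^ j)"
            by (simp add: sum_distrib_left power_add mult_ac)
          finally show ?thesis .
        qed
        have "rel e' a"
          using aC less.prems vanP by (simp add: rel_def van_def eq)
        from less.IH[OF _ this] eq[of x] that(3,4) e' show ?thesis by simp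
      qed
    qed
    have "\<exists>r>0. \<forall>q\<in>cylinder_closure C V. (\<forall>a\<in>C. \<bar>q a - p a\<bar> < r) \<longrightarrow>
        (\<exists>t. \<bar>t - p b\<bar> < e \<and> q(b := t) \<in> cylinder_closure (insert b C) V)"
      if p: "p \<in> V" "h p \<noteq> 0" and e: "e > 0" for p e
    proof -
      define R where "R q = (\<Sum>j\<le>d. monom (c j q) j)" for q
      have R: "poly (R q) t = (\<Sum>j\<le>d. c j q * t ^ j)" for q t
        by (simp add: R_def poly_sum poly_monom)
      have root: "poly (R p) (p b) = 0" using vanP[OF p(1)] by (simp add: R)
      have sum_deriv: "pderiv (\<Sum>j\<in>I. g j) = (\<Sum>j\<in>I. pderiv (g j))"
        for g :: "nat \<Rightarrow> real poly" and I
        by (induction I rule: infinite_finite_induct) (simp_all add: pderiv_add)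
      have "poly (pderiv (R p)) (p b) = P' p"
        unfolding R_def P'_def sum_deriv poly_sum d'
        by (subst sum.atMost_Suc_shift) (simp add: pderiv_monom poly_monom)
      then have "poly (pderiv (R p)) (p b) \<noteq> 0" using p(2) by (simp add: h_def)
      from simple_root_sign_change[OF root this e] obtain s u where su:
        "p b - e < s" "s < p b" "p b < u" "u < p b + e" "poly (R p) s * poly (R p) u < 0" .
      have RC: "(\<lambda>q. poly (R q) t) \<in> poly_funs C" for t
        unfolding R by (intro poly_funs_sum poly_funs.mult cC poly_funs.const)
      \<comment> \<open>Opposite signs at the fixed points \<open>s\<close> and \<open>u\<close> are
        an open condition on the coordinates in \<open>C\<close>: a deviation below
        \<open>- g p\<close> keeps \<open>g\<close> negative, and the intermediate value theorem
        then gives the perturbed root.\<close>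
      define g where "g = (\<lambda>q. poly (R q) s * poly (R q) u)"
      have gC: "g \<in> poly_funs C" unfolding g_def by (intro poly_funs.mult RC)
      obtain r1 where r1: "r1 > 0" "\<And>q. \<forall>a\<in>C. \<bar>q a - p a\<bar> < r1 \<Longrightarrow> \<bar>g q - g p\<bar> < - g p"
        using poly_funs_eventually_close[OF gC, of "- g p" p] su(5) by (auto simp: g_def)
      have "c d p \<noteq> 0" using p(2) by (simp add: h_def)
      then obtain r2 where r2: "r2 > 0" "\<And>q. \<forall>a\<in>C. \<bar>q a - p a\<bar> < r2 \<Longrightarrow> \<bar>c d q - c d p\<bar> < \<bar>c d p\<bar>"
        using poly_funs_eventually_close[OF cC, of "\<bar>c d p\<bar>" p d] by auto
      show ?thesis
      proof (rule exI[of _ "min r1 r2"], intro conjI ballI impI)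
        fix q assume q: "q \<in> cylinder_closure C V" "\<forall>a\<in>C. \<bar>q a - p a\<bar> < min r1 r2"
        have "g q < 0" using r1(2)[of q] q(2) by auto
        then have "poly (R q) s * poly (R q) u < 0" by (simp add: g_def)
        from poly_IVT[OF _ this] su obtain t where t: "s < t" "t < u" "poly (R q) t = 0" by auto
        have cd: "c d q \<noteq> 0" using r2(2)[of q] q(2) by auto
        have qt: "q(b := t) \<in> cylinder_closure C V"
          using q(1) unfolding cylinder_closure_def by (simp add: upd[of _ q t])
        have "q(b := t) \<in> cylinder_closure (insert b C) V"
          unfolding cylinder_closure_def
        proof safe
          fix f assume f: "f \<in> poly_funs (insert b C)" "\<forall>y\<in>V. f y = 0"
          obtain k c' where c': "\<And>j. c' j \<in> poly_funs C" "f = (\<lambda>x. \<Sum>j\<le>k. c' j x * x b ^ j)"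
            using poly_funs_expand[OF f(1)] by blast
          have "rel k c'" using f(2) c' by (auto simp: rel_def van_def)
          from division[OF this qt] t(3) cd show "f (q(b := t)) = 0"
            by (simp add: c'(2) R upd[OF cC])
        qed
        with t su show "\<exists>t. \<bar>t - p b\<bar> < e \<and> q(b := t) \<in> cylinder_closure (insert b C) V"
          by (intro exI[of _ t]) auto
      qed (use r1 r2 in auto)
    qed
    with hC \<open>\<exists>p\<in>V. h p \<noteq> 0\<close> show ?thesis by blast
  qed
qed

text \<open>Induction over \<open>B\<close>: one variable is lifted by the previous lemma, the
  others by the induction hypothesis for \<open>insert b A\<close>. The product of the two
  exceptional polynomials is nonzero somewhere on \<open>V\<close> by irreducibility.\<close>

lemma cylinder_closure_projection_open:
  fixes V :: "('i \<Rightarrow> real) set"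
  assumes irr: "zariski_irreducible V" and "finite B" "A \<inter> B = {}"
  shows "\<exists>h\<in>poly_funs (A \<union> B). (\<exists>p\<in>V. h p \<noteq> 0) \<and>
    (\<forall>p\<in>V. h p \<noteq> 0 \<longrightarrow> (\<exists>d>0. \<forall>q\<in>cylinder_closure A V. (\<forall>a\<in>A. \<bar>q a - p a\<bar> < d) \<longrightarrow>
      (\<exists>x\<in>cylinder_closure (A \<union> B) V. \<forall>a\<in>A. x a = q a)))"
  using assms(2,3)
proof (induction B arbitrary: A)
  case empty
  show ?case using irr
    by (intro bexI[of _ "\<lambda>_. 1"])
       (auto intro: poly_funs.const exI[of _ 1] simp: zariski_irreducible_def)
next
  case (insert b B)
  have "insert b A \<inter> B = {}" using insert.prems insert.hyps by auto
  from insert.IH[OF this] obtain h where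
    h: "h \<in> poly_funs (insert b A \<union> B)" "\<exists>p\<in>V. h p \<noteq> 0"
    and open_h: "\<And>p. p \<in> V \<Longrightarrow> h p \<noteq> 0 \<Longrightarrow> \<exists>d>0. \<forall>q\<in>cylinder_closure (insert b A) V.
      (\<forall>a\<in>insert b A. \<bar>q a - p a\<bar> < d) \<longrightarrow>
      (\<exists>x\<in>cylinder_closure (insert b A \<union> B) V. \<forall>a\<in>insert b A. x a = q a)"
    by blast
  have "b \<notin> A" using insert.prems by auto
  from cylinder_closure_projection_open_step[OF irr this] obtain g where
    g: "g \<in> poly_funs (insert b A)" "\<exists>p\<in>V. g p \<noteq> 0"
    and open_g: "\<And>p e. p \<in> V \<Longrightarrow> g p \<noteq> 0 \<Longrightarrow> e > 0 \<Longrightarrow> \<exists>d>0. \<forall>q\<in>cylinder_closure A V.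
      (\<forall>a\<in>A. \<bar>q a - p a\<bar> < d) \<longrightarrow>
      (\<exists>t. \<bar>t - p b\<bar> < e \<and> q(b := t) \<in> cylinder_closure (insert b A) V)"
    by blast
  have sets: "insert b A \<union> B = A \<union> insert b B" by auto
  have "\<exists>d>0. \<forall>q\<in>cylinder_closure A V. (\<forall>a\<in>A. \<bar>q a - p a\<bar> < d) \<longrightarrow>
      (\<exists>x\<in>cylinder_closure (A \<union> insert b B) V. \<forall>a\<in>A. x a = q a)"
    if p: "p \<in> V" "h p * g p \<noteq> 0" for p
  proof -
    obtain d1 where d1: "d1 > 0" "\<And>q. q \<in> cylinder_closure (insert b A) V \<Longrightarrow>
      \<forall>a\<in>insert b A. \<bar>q a - p a\<bar> < d1 \<Longrightarrow>
      \<exists>x\<in>cylinder_closure (insert b A \<union> B) V. \<forall>a\<in>insert b A. x a = q a"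
      using open_h[of p] p by force
    \<comment> \<open>The new coordinate is requested within \<open>d1\<close> of
      \<open>p b\<close>, so that the lifted point lies in the neighbourhood where the induction
      hypothesis applies.\<close>
    obtain d2 where d2: "d2 > 0" "\<And>q. q \<in> cylinder_closure A V \<Longrightarrow> \<forall>a\<in>A. \<bar>q a - p a\<bar> < d2 \<Longrightarrow>
      \<exists>t. \<bar>t - p b\<bar> < d1 \<and> q(b := t) \<in> cylinder_closure (insert b A) V"
      using open_g[of p d1] p d1(1) by force
    show ?thesis
    proof (intro exI[of _ "min d1 d2"] conjI ballI impI)
      fix q assume q: "q \<in> cylinder_closure A V" "\<forall>a\<in>A. \<bar>q a - p a\<bar> < min d1 d2"
      then obtain t where t: "\<bar>t - p b\<bar> < d1" "q(b := t) \<in> cylinder_closure (insert b A) V"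
        using d2(2)[of q] by auto
      have "\<forall>a\<in>insert b A. \<bar>(q(b := t)) a - p a\<bar> < d1" using q(2) t(1) by auto
      from d1(2)[OF t(2) this] obtain x where
        "x \<in> cylinder_closure (insert b A \<union> B) V" "\<forall>a\<in>insert b A. x a = (q(b := t)) a"
        by blast
      with \<open>b \<notin> A\<close> show "\<exists>x\<in>cylinder_closure (A \<union> insert b B) V. \<forall>a\<in>A. x a = q a"
        unfolding sets by (intro bexI[of _ x]) auto
    qed (use d1 d2 in auto)
  qed
  moreover have "(\<lambda>x. h x * g x) \<in> poly_funs (A \<union> insert b B)"
    using h(1) g(1) by (intro poly_funs.mult) (auto intro: poly_funs_mono simp: sets)
  moreover have "\<exists>p\<in>V. h p * g p \<noteq> 0"
  proof -
    have "h \<in> poly_funs UNIV" "g \<in> poly_funs UNIV" using h(1) g(1) by (auto intro: poly_funs_mono)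
    then show ?thesis
      using irr h(2) g(2) unfolding zariski_irreducible_def by (metis mult_eq_0_iff)
  qed
  ultimately show ?case by (intro bexI[of _ "\<lambda>x. h x * g x"]) auto
qed

text \<open>Density of the projection to \<open>A\<close> makes membership in its closure automatic,
  so any \<open>p\<close> in \<open>V\<close> with \<open>h p\<close> nonzero can be the centre of
  the box.\<close>

lemma cylinder_closure_contains_box:
  fixes V :: "('i \<Rightarrow> real) set"
  assumes irr: "zariski_irreducible V" and AB: "finite B" "A \<inter> B = {}"
    and dominant: "cylinder_closure A V = UNIV"
  shows "\<exists>p. \<exists>d>0. \<forall>q. (\<forall>a\<in>A. \<bar>q a - p a\<bar> < d) \<longrightarrow> (\<exists>x\<in>cylinder_closure (A \<union> B) V. \<forall>a\<in>A. x a = q a)"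
proof -
  from cylinder_closure_projection_open[OF irr AB] obtain h :: "('i \<Rightarrow> real) \<Rightarrow> real" where
    h: "(\<exists>p\<in>V. h p \<noteq> 0) \<and> (\<forall>p\<in>V. h p \<noteq> 0 \<longrightarrow> (\<exists>d>0. \<forall>q\<in>cylinder_closure A V.
      (\<forall>a\<in>A. \<bar>q a - p a\<bar> < d) \<longrightarrow> (\<exists>x\<in>cylinder_closure (A \<union> B) V. \<forall>a\<in>A. x a = q a)))"
    by (rule bexE) (rule that, assumption)
  then obtain p where p: "p \<in> V" "h p \<noteq> 0" by (elim conjE bexE)
  from mp[OF bspec[OF conjunct2[OF h] p(1)] p(2)] obtain d where d: "d > 0" "\<forall>q\<in>cylinder_closure A V.
      (\<forall>a\<in>A. \<bar>q a - p a\<bar> < d) \<longrightarrow> (\<exists>x\<in>cylinder_closure (A \<union> B) V. \<forall>a\<in>A. x a = q a)"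
    by (elim exE conjE)
  show ?thesis
    using d unfolding dominant by (intro exI[of _ p] exI[of _ d]) simp
qed

section \<open>Homogeneous polynomials\<close>

abbreviation (input) of_real_mpoly :: "(real, 'n) mpoly \<Rightarrow> (complex, 'n) mpoly" where
  "of_real_mpoly \<equiv> Poly_Mapping.map complex_of_real"

text \<open>Fixing the degree lets scaling be expressed by a power. The zero polynomial has every
  degree, so homogeneous parts may be zero.\<close>

definition homogeneous_of_degree :: "nat \<Rightarrow> ('a::field, 'n::finite) mpoly \<Rightarrow> bool" where
  "homogeneous_of_degree d p \<longleftrightarrow>
     (\<forall>m\<in>Poly_Mapping.keys p. (\<Sum>i\<in>UNIV. Poly_Mapping.lookup m i) = d)"

lemma homogeneous_iff: "homogeneous p \<longleftrightarrow> (\<exists>d. homogeneous_of_degree d p)"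
  by (simp add: homogeneous_def homogeneous_of_degree_def)

lemma eval_mpoly_superset:
  assumes "finite K" "Poly_Mapping.keys p \<subseteq> K"
  shows "eval_mpoly p x =
    (\<Sum>m\<in>K. Poly_Mapping.lookup p m * (\<Prod>i\<in>UNIV. x $ i ^ Poly_Mapping.lookup m i))"
  unfolding eval_mpoly_def
  by (rule sum.mono_neutral_left) (use assms in \<open>auto simp: in_keys_iff\<close>)

lemma eval_mpoly_add: "eval_mpoly (p + q) x = eval_mpoly p x + eval_mpoly q x"
proof -
  let ?K = "Poly_Mapping.keys p \<union> Poly_Mapping.keys q"
  show ?thesis
    by (subst (1 2 3) eval_mpoly_superset[of ?K])
       (auto simp: lookup_add distrib_right sum.distrib dest: subsetD[OF Poly_Mapping.keys_add])
qed

lemma eval_mpoly_zero [simp]: "eval_mpoly 0 x = 0"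
  by (simp add: eval_mpoly_def)

lemma eval_mpoly_sum: "eval_mpoly (\<Sum>i\<in>I. p i) x = (\<Sum>i\<in>I. eval_mpoly (p i) x)"
  by (induction I rule: infinite_finite_induct) (simp_all add: eval_mpoly_add)

lemma eval_mpoly_single:
  "eval_mpoly (Poly_Mapping.single m c) x = c * (\<Prod>i\<in>UNIV. x $ i ^ Poly_Mapping.lookup m i)"
  by (simp add: eval_mpoly_def)

lemma eval_mpoly_coordinate:
  "eval_mpoly (Poly_Mapping.single (Poly_Mapping.single a 1) 1) x = x $ a"
proof -
  have "(\<Prod>i\<in>UNIV. x $ i ^ Poly_Mapping.lookup (Poly_Mapping.single a 1) i) =
      (\<Prod>i\<in>UNIV. if i = a then x $ i else 1)"
    by (rule prod.cong) (auto simp: lookup_single when_def)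
  then show ?thesis by (simp add: eval_mpoly_single)
qed

lemma mpoly_sum_single:
  "(\<Sum>m\<in>Poly_Mapping.keys p. Poly_Mapping.single m (Poly_Mapping.lookup p m)) = p"
  by (rule poly_mapping_eqI) (auto simp: lookup_sum lookup_single when_def in_keys_iff)

lemma eval_mpoly_mult: "eval_mpoly (p * q) x = eval_mpoly p x * eval_mpoly q x"
proof -
  let ?s = "\<lambda>p m. Poly_Mapping.single m (Poly_Mapping.lookup p m)"
  have "p * q = (\<Sum>m\<in>Poly_Mapping.keys p. ?s p m) * (\<Sum>m\<in>Poly_Mapping.keys q. ?s q m)"
    by (simp add: mpoly_sum_single)
  also have "eval_mpoly \<dots> x = (\<Sum>m\<in>Poly_Mapping.keys p. \<Sum>m'\<in>Poly_Mapping.keys q.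
      eval_mpoly (?s p m) x * eval_mpoly (?s q m') x)"
    by (simp add: sum_product eval_mpoly_sum mult_single eval_mpoly_single lookup_add power_add
        prod.distrib mult_ac)
  also have "\<dots> = eval_mpoly (\<Sum>m\<in>Poly_Mapping.keys p. ?s p m) x * eval_mpoly (\<Sum>m\<in>Poly_Mapping.keys q. ?s q m) x"
    by (simp add: sum_product eval_mpoly_sum)
  finally show ?thesis by (simp add: mpoly_sum_single)
qed

lemma homogeneous_of_degree_mult:
  assumes "homogeneous_of_degree d p" "homogeneous_of_degree e q"
  shows "homogeneous_of_degree (d + e) (p * q)"
  unfolding homogeneous_of_degree_def
proof
  fix m assume "m \<in> Poly_Mapping.keys (p * q)"
  then obtain a b where "a \<in> Poly_Mapping.keys p" "b \<in> Poly_Mapping.keys q" "m = a + b"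
    using keys_mult by blast
  then show "(\<Sum>i\<in>UNIV. Poly_Mapping.lookup m i) = d + e"
    using assms by (simp add: homogeneous_of_degree_def lookup_add sum.distrib)
qed

lemma lookup_of_real_mpoly:
  "Poly_Mapping.lookup (of_real_mpoly p) m = complex_of_real (Poly_Mapping.lookup p m)"
  by (simp add: Poly_Mapping.map.rep_eq when_def)

lemma of_real_mpoly_mult: "of_real_mpoly (p * q) = of_real_mpoly p * of_real_mpoly q"
proof -
  have add: "of_real_mpoly (p + q) = of_real_mpoly p + of_real_mpoly q" for p q
    by (rule poly_mapping_eqI) (simp add: lookup_of_real_mpoly lookup_add)
  have zero: "of_real_mpoly 0 = 0"
    by (rule poly_mapping_eqI) (simp add: lookup_of_real_mpoly)
  have sum: "of_real_mpoly (\<Sum>i\<in>I. f i) = (\<Sum>i\<in>I. of_real_mpoly (f i))"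
    for f :: "('a \<Rightarrow>\<^sub>0 nat) \<Rightarrow> _" and I
    by (induction I rule: infinite_finite_induct) (simp_all add: add zero)
  let ?s = "\<lambda>p m. Poly_Mapping.single m (Poly_Mapping.lookup p m)"
  have "of_real_mpoly ((\<Sum>m\<in>Poly_Mapping.keys p. ?s p m) * (\<Sum>m\<in>Poly_Mapping.keys q. ?s q m)) =
    of_real_mpoly (\<Sum>m\<in>Poly_Mapping.keys p. ?s p m) * of_real_mpoly (\<Sum>m\<in>Poly_Mapping.keys q. ?s q m)"
    by (simp add: sum_product sum mult_single)
  then show ?thesis by (simp add: mpoly_sum_single)
qed

lemma eval_of_real_mpoly:
  "eval_mpoly (of_real_mpoly p) z =
    (\<Sum>m\<in>Poly_Mapping.keys p. complex_of_real (Poly_Mapping.lookup p m) * (\<Prod>i\<in>UNIV. z $ i ^ Poly_Mapping.lookup m i))"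
  by (subst eval_mpoly_superset[of "Poly_Mapping.keys p"]) (auto simp: lookup_of_real_mpoly in_keys_iff)

lemma eval_of_real_mpoly_complex_vec:
  "eval_mpoly (of_real_mpoly p) (complex_vec v) = complex_of_real (eval_mpoly p v)"
  by (simp add: eval_of_real_mpoly complex_vec_def eval_mpoly_def[of p])

lemma homogeneous_of_real_mpoly:
  "homogeneous_of_degree d p \<Longrightarrow> homogeneous_of_degree d (of_real_mpoly p)"
  by (auto simp: homogeneous_of_degree_def in_keys_iff lookup_of_real_mpoly)

lemma homogeneous_of_real_mpoly_image:
  "\<forall>p\<in>E. homogeneous p \<Longrightarrow> \<forall>p\<in>of_real_mpoly ` E. homogeneous p"
  unfolding homogeneous_iff using homogeneous_of_real_mpoly by blast

lemma eval_mpoly_scale: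
  assumes "homogeneous_of_degree d p"
  shows "eval_mpoly p (c *s x) = c ^ d * eval_mpoly p x"
proof -
  have "Poly_Mapping.lookup p m * (\<Prod>i\<in>UNIV. (c *s x) $ i ^ Poly_Mapping.lookup m i) =
      c ^ d * (Poly_Mapping.lookup p m * (\<Prod>i\<in>UNIV. x $ i ^ Poly_Mapping.lookup m i))"
    if "m \<in> Poly_Mapping.keys p" for m
    using assms that
    by (simp add: homogeneous_of_degree_def power_mult_distrib prod.distrib mult_ac flip: power_sum)
  then show ?thesis
    unfolding eval_mpoly_def sum_distrib_left by (rule sum.cong[OF refl])
qed

lemma poly_funs_eval_mpoly:
  assumes "\<And>i. (\<lambda>x. s x $ i) \<in> poly_funs A"
  shows "(\<lambda>x. eval_mpoly p (s x)) \<in> poly_funs A"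
  unfolding eval_mpoly_def
  by (intro poly_funs_sum poly_funs_prod poly_funs_power poly_funs.mult poly_funs.const assms)

lemma poly_funs_imp_eval_mpoly:
  fixes f :: "('n::finite \<Rightarrow> 'a::field) \<Rightarrow> 'a"
  assumes "f \<in> poly_funs UNIV"
  shows "\<exists>q. \<forall>x. f (($) x) = eval_mpoly q x"
  using assms
proof induction
  case (const c)
  show ?case by (rule exI[of _ "Poly_Mapping.single 0 c"]) (simp add: eval_mpoly_single)
next
  case (coord a)
  show ?case
    by (rule exI[of _ "Poly_Mapping.single (Poly_Mapping.single a 1) 1"]) (simp only: eval_mpoly_coordinate simp_thms)
next
  case (add f g)
  then obtain p q where "\<And>x. f (($) x) = eval_mpoly p x" "\<And>x. g (($) x) = eval_mpoly q x" by blast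
  then show ?case by (intro exI[of _ "p + q"]) (simp add: eval_mpoly_add)
next
  case (mult f g)
  then obtain p q where "\<And>x. f (($) x) = eval_mpoly p x" "\<And>x. g (($) x) = eval_mpoly q x" by blast
  then show ?case by (intro exI[of _ "p * q"]) (simp add: eval_mpoly_mult)
qed

text \<open>Monomials are grouped by total degree. This reduces arbitrary polynomial functions to
  the homogeneous equations by which varieties are given.\<close>

lemma poly_funs_homogeneous_parts:
  fixes f :: "('n::finite \<Rightarrow> 'a::field) \<Rightarrow> 'a"
  assumes "f \<in> poly_funs UNIV"
  obtains N p where "\<And>d. homogeneous_of_degree d (p d)"
    and "\<And>x. f (($) x) = (\<Sum>d\<le>N. eval_mpoly (p d) x)"
proof -
  obtain q where q: "\<And>x. f (($) x) = eval_mpoly q x"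
    using poly_funs_imp_eval_mpoly[OF assms] by blast
  define deg where "deg m = (\<Sum>i\<in>UNIV. Poly_Mapping.lookup m i)" for m :: "'n \<Rightarrow>\<^sub>0 nat"
  define K where "K d = {m \<in> Poly_Mapping.keys q. deg m = d}" for d
  define p where "p d = (\<Sum>m\<in>K d. Poly_Mapping.single m (Poly_Mapping.lookup q m))" for d
  \<comment> \<open>Inserting \<open>0\<close> keeps \<open>Max\<close> meaningful for the zero
    polynomial.\<close>
  define N where "N = Max (insert 0 (deg ` Poly_Mapping.keys q))"
  have "homogeneous_of_degree d (p d)" for d
    unfolding homogeneous_of_degree_def
  proof
    fix m assume "m \<in> Poly_Mapping.keys (p d)"
    then have "m \<in> K d"
      by (rule contrapos_pp)
         (auto simp: p_def in_keys_iff lookup_sum lookup_single when_def intro!: sum.neutral)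
    then show "(\<Sum>i\<in>UNIV. Poly_Mapping.lookup m i) = d"
      by (simp add: K_def deg_def)
  qed
  moreover have "f (($) x) = (\<Sum>d\<le>N. eval_mpoly (p d) x)" for x
  proof -
    have "deg ` Poly_Mapping.keys q \<subseteq> {..N}" by (auto simp: N_def)
    from sum.group[OF _ _ this, of "\<lambda>m. Poly_Mapping.lookup q m * (\<Prod>i\<in>UNIV. x $ i ^ Poly_Mapping.lookup m i)"]
    show ?thesis
      by (simp add: q p_def eval_mpoly_sum eval_mpoly_single K_def eval_mpoly_def[of q])
  qed
  ultimately show ?thesis by (rule that)
qed

text \<open>Real and imaginary parts are taken of the coefficients, not of the values, so the
  identity holds at complex points too. It carries density, which speaks of real equations only,
  over to complex polynomials.\<close>

lemma eval_mpoly_Re_Im: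
  fixes p :: "(complex, 'n::finite) mpoly"
  assumes "homogeneous_of_degree d p"
  obtains a b where "homogeneous_of_degree d a" "homogeneous_of_degree d b"
    "\<And>z. eval_mpoly p z = eval_mpoly (of_real_mpoly a) z + \<i> * eval_mpoly (of_real_mpoly b) z"
proof
  define a where "a = Poly_Mapping.map Re p"
  define b where "b = Poly_Mapping.map Im p"
  have look: "Poly_Mapping.lookup a m = Re (Poly_Mapping.lookup p m)"
    "Poly_Mapping.lookup b m = Im (Poly_Mapping.lookup p m)" for m
    by (simp_all add: a_def b_def Poly_Mapping.map.rep_eq when_def)
  show "homogeneous_of_degree d a" "homogeneous_of_degree d b"
    using assms by (auto simp: homogeneous_of_degree_def in_keys_iff look)
  show "eval_mpoly p z = eval_mpoly (of_real_mpoly a) z + \<i> * eval_mpoly (of_real_mpoly b) z" for z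
  proof -
    have "Poly_Mapping.keys (of_real_mpoly a) \<subseteq> Poly_Mapping.keys p"
      "Poly_Mapping.keys (of_real_mpoly b) \<subseteq> Poly_Mapping.keys p"
      by (auto simp: in_keys_iff look lookup_of_real_mpoly)
    then have "eval_mpoly (of_real_mpoly a) z + \<i> * eval_mpoly (of_real_mpoly b) z =
      (\<Sum>m\<in>Poly_Mapping.keys p. (complex_of_real (Re (Poly_Mapping.lookup p m)) + \<i> * complex_of_real (Im (Poly_Mapping.lookup p m))) * (\<Prod>i\<in>UNIV. z $ i ^ Poly_Mapping.lookup m i))"
      by (simp add: eval_mpoly_superset[of "Poly_Mapping.keys p"] lookup_of_real_mpoly look
          sum_distrib_left distrib_right sum.distrib mult.assoc)
    then show ?thesis
      by (simp add: eval_mpoly_def[of p] flip: complex_eq)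
  qed
qed

text \<open>The real numbers already give infinitely many roots of a complex polynomial.\<close>

lemma polynomial_coeffs_zero:
  fixes c :: "nat \<Rightarrow> complex"
  assumes "\<And>t. (\<Sum>d\<le>N. complex_of_real t ^ d * c d) = 0" "d \<le> N"
  shows "c d = 0"
proof -
  define P where "P = (\<Sum>d\<le>N. monom (c d) d)"
  have "poly P (complex_of_real t) = 0" for t
    using assms(1)[of t] by (simp add: P_def poly_sum poly_monom mult.commute)
  then have "range complex_of_real \<subseteq> {z. poly P z = 0}" by auto
  moreover have "infinite (range complex_of_real)"
    by (simp add: finite_image_iff inj_of_real infinite_UNIV_char_0)
  ultimately have "P = 0" using poly_roots_finite finite_subset by blast
  then have "coeff P d = 0" by simp
  then show ?thesis using assms(2) by (simp add: P_def coeff_sum)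
qed

section \<open>Sums of points of an irreducible set\<close>

text \<open>At each index, irreducibility of \<open>X\<close> supplies one value \<open>t\<close> at
  which both functions stay nonzero, and it replaces the arguments of both families. Agreement from
  \<open>r\<close> onward makes the families equal once all indices are treated. This is the
  irreducibility of the \<open>r\<close>-fold product of \<open>X\<close>.\<close>

lemma separately_polynomial_irreducible:
  fixes F G :: "(nat \<Rightarrow> 'i \<Rightarrow> 'a::comm_ring_1) \<Rightarrow> 'a"
  assumes irr: "zariski_irreducible X"
    and F: "\<And>u k. (\<lambda>t. F (u(k := t))) \<in> poly_funs UNIV"
    and G: "\<And>u k. (\<lambda>t. G (u(k := t))) \<in> poly_funs UNIV"
    and "\<And>i. i < r \<Longrightarrow> u i \<in> X" "\<And>i. i < r \<Longrightarrow> w i \<in> X" "\<And>i. i \<ge> r \<Longrightarrow> u i = w i"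
    and "F u \<noteq> 0" "G w \<noteq> 0"
  shows "\<exists>x. (\<forall>i<r. x i \<in> X) \<and> (\<forall>i\<ge>r. x i = u i) \<and> F x \<noteq> 0 \<and> G x \<noteq> 0"
  using assms(4-)
proof (induction r arbitrary: u w)
  case 0
  then have "u = w" by auto
  with 0 show ?case by auto
next
  case (Suc r)
  have "F (u(r := u r)) \<noteq> 0" "G (w(r := w r)) \<noteq> 0" "u r \<in> X" "w r \<in> X" using Suc.prems by auto
  from zariski_irreducibleD[OF irr F[of u r] G[of w r], of "u r" "w r", OF this(3,4,1,2)] obtain t where
    t: "t \<in> X" "F (u(r := t)) \<noteq> 0" "G (w(r := t)) \<noteq> 0" by blast
  have "\<exists>x. (\<forall>i<r. x i \<in> X) \<and> (\<forall>i\<ge>r. x i = (u(r := t)) i) \<and> F x \<noteq> 0 \<and> G x \<noteq> 0"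
    by (rule Suc.IH[of _ "w(r := t)"]) (use Suc.prems t in \<open>auto simp del: fun_upd_apply\<close>, auto)
  then obtain x where "\<forall>i<r. x i \<in> X" "\<forall>i\<ge>r. x i = (u(r := t)) i" "F x \<noteq> 0" "G x \<noteq> 0" by blast
  with t(1) show ?case by (intro exI[of _ x]) (auto simp: less_Suc_eq)
qed

text \<open>The graph of summation is irreducible, and by \<open>no_hypersurface\<close> its
  projection to the sum is Zariski dense, so a box of vectors lifts to the closure of the graph. The
  equations of \<open>X\<close> and of summation persist there, so the lifts are genuine
  decompositions.\<close>

lemma sums_contain_box:
  fixes X :: "('n::finite \<Rightarrow> real) set"
  assumes irr: "zariski_irreducible X" and closed: "cylinder_closure UNIV X \<subseteq> X"
    and no_hypersurface: "\<forall>f\<in>poly_funs UNIV.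
      (\<forall>u. (\<forall>i<r. u i \<in> X) \<longrightarrow> f (\<lambda>j. \<Sum>i<r. u i j) = 0) \<longrightarrow> (\<forall>x. f x = 0)"
  shows "\<exists>p. \<exists>d>0. \<forall>q. (\<forall>j. \<bar>q j - p j\<bar> < d) \<longrightarrow> (\<exists>u. (\<forall>i<r. u i \<in> X) \<and> q = (\<lambda>j. \<Sum>i<r::nat. u i j))"
proof -
  define graph :: "(nat \<Rightarrow> 'n \<Rightarrow> real) \<Rightarrow> 'n + 'n \<times> nat \<Rightarrow> real"
    where "graph u = case_sum (\<lambda>j. \<Sum>i<r. u i j) (\<lambda>(j, i). u i j)" for u
  \<comment> \<open>Summands from \<open>r\<close> onward are fixed at zero, so that any two
    families in \<open>D\<close> agree there, as the irreducibility of the product requires.\<close>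
  define D where "D = {u. (\<forall>i<r. u i \<in> X) \<and> (\<forall>i\<ge>r. u i = (\<lambda>_. 0))}"
  define A :: "('n + 'n \<times> nat) set" where "A = range Inl"
  define B :: "('n + 'n \<times> nat) set" where "B = Inr ` (UNIV \<times> {..<r})"
  have separate: "(\<lambda>t. f (graph (u(k := t)))) \<in> poly_funs UNIV" if "f \<in> poly_funs UNIV" for f u k
  proof (rule poly_funs_subst[OF that])
    have *: "(\<lambda>t. (u(k := t)) i j) \<in> poly_funs UNIV" for i j
      by (cases "i = k") (simp_all add: poly_funs.const poly_funs.coord)
    show "(\<lambda>t. graph (u(k := t)) a) \<in> poly_funs UNIV" for a
      by (cases a) (auto simp: graph_def simp del: fun_upd_apply intro!: poly_funs_sum *)
  qed
  have irr_graph: "zariski_irreducible (graph ` D)"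
    unfolding zariski_irreducible_def
  proof (intro conjI ballI impI)
    obtain a where "a \<in> X" using irr by (auto simp: zariski_irreducible_def)
    then have "(\<lambda>i. if i < r then a else (\<lambda>_. 0)) \<in> D" by (auto simp: D_def)
    then show "graph ` D \<noteq> {}" by blast
  next
    fix f g x y assume fg: "f \<in> poly_funs UNIV" "g \<in> poly_funs UNIV"
      and xy: "x \<in> graph ` D" "y \<in> graph ` D" "f x \<noteq> 0" "g y \<noteq> 0"
    from xy obtain u w where uw: "x = graph u" "y = graph w" "u \<in> D" "w \<in> D" by auto
    have "\<exists>x. (\<forall>i<r. x i \<in> X) \<and> (\<forall>i\<ge>r. x i = u i) \<and> f (graph x) \<noteq> 0 \<and> g (graph x) \<noteq> 0"
      by (rule separately_polynomial_irreducible[OF irr, where w = w])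
         (use fg xy uw separate in \<open>auto simp: D_def simp del: fun_upd_apply\<close>)
    then show "\<exists>z\<in>graph ` D. f z \<noteq> 0 \<and> g z \<noteq> 0"
      using uw(3) by (auto simp: D_def)
  qed
  have AB: "finite B" "A \<inter> B = {}" by (auto simp: A_def B_def)
  have dominant: "f x = 0" if f: "f \<in> poly_funs A" "\<forall>y\<in>graph ` D. f y = 0" for f x
  proof -
    \<comment> \<open>As \<open>f\<close> involves only the coordinates of the sum, filling the
      others with zero loses nothing.\<close>
    define f' where "f' = (\<lambda>y. f (case_sum y (\<lambda>_. 0)))"
    have "f' \<in> poly_funs UNIV"
      unfolding f'_def by (rule poly_funs_subst[OF f(1)]) (auto simp: A_def poly_funs.coord)
    moreover have "f' (\<lambda>j. \<Sum>i<r. u i j) = 0" if "\<forall>i<r. u i \<in> X" for u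
    proof -
      define u' where "u' i = (if i < r then u i else (\<lambda>_. 0))" for i
      have "u' \<in> D" using that by (auto simp: D_def u'_def)
      then have "f (graph u') = 0" using f(2) by blast
      moreover have "f' (\<lambda>j. \<Sum>i<r. u i j) = f (graph u')"
        unfolding f'_def by (rule poly_funs_cong[OF f(1)]) (auto simp: A_def graph_def u'_def)
      ultimately show ?thesis by simp
    qed
    ultimately have "f' (x \<circ> Inl) = 0" using no_hypersurface by simp
    moreover have "f x = f' (x \<circ> Inl)"
      unfolding f'_def by (rule poly_funs_cong[OF f(1)]) (auto simp: A_def)
    ultimately show ?thesis by simp
  qed
  then have "cylinder_closure A (graph ` D) = UNIV" by (auto simp: cylinder_closure_def)
  from cylinder_closure_contains_box[OF irr_graph AB this] obtain p d where
    d: "d > 0" "\<And>q. \<forall>a\<in>A. \<bar>q a - p a\<bar> < d \<Longrightarrow>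
      \<exists>x\<in>cylinder_closure (A \<union> B) (graph ` D). \<forall>a\<in>A. x a = q a"
    by blast
  show ?thesis
  proof (rule exI[of _ "p \<circ> Inl"], rule exI[of _ d], intro conjI d allI impI)
    fix q assume "\<forall>j. \<bar>q j - (p \<circ> Inl) j\<bar> < d"
    then obtain x where x: "x \<in> cylinder_closure (A \<union> B) (graph ` D)" "\<forall>a\<in>A. x a = case_sum q (\<lambda>_. 0) a"
      using d(2)[of "case_sum q (\<lambda>_. 0)"] by (auto simp: A_def)
    \<comment> \<open>Used twice below: for the equations of \<open>X\<close> in each summand, and
      for the linear relation between the sum and its summands.\<close>
    have zero: "f x = 0" if "f \<in> poly_funs (A \<union> B)" "\<And>u. u \<in> D \<Longrightarrow> f (graph u) = 0" for f
      using x(1) that by (auto simp: cylinder_closure_def)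
    define u where "u i j = x (Inr (j, i))" for i j
    have "u i \<in> X" if "i < r" for i
    proof -
      have "f (u i) = 0" if f: "f \<in> poly_funs UNIV" "\<forall>y\<in>X. f y = 0" for f
      proof -
        have "(\<lambda>x. f (\<lambda>j. x (Inr (j, i)))) \<in> poly_funs (A \<union> B)"
          by (rule poly_funs_subst[OF f(1)]) (use \<open>i < r\<close> in \<open>auto simp: B_def intro!: poly_funs.coord\<close>)
        moreover have "f (\<lambda>j. graph w (Inr (j, i))) = 0" if "w \<in> D" for w
          using that f(2) \<open>i < r\<close> by (auto simp: graph_def D_def)
        ultimately show ?thesis unfolding u_def by (rule zero)
      qed
      then show ?thesis using closed by (auto simp: cylinder_closure_def)
    qed
    moreover have "q j = (\<Sum>i<r. u i j)" for j
    proof -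
      have "(\<lambda>x. x (Inl j) - (\<Sum>i<r. x (Inr (j, i)))) \<in> poly_funs (A \<union> B)"
        by (intro poly_funs_diff poly_funs_sum poly_funs.coord) (auto simp: A_def B_def)
      then have "x (Inl j) - (\<Sum>i<r. x (Inr (j, i))) = 0"
        by (rule zero) (simp add: graph_def)
      then show ?thesis using x(2) by (simp add: A_def u_def)
    qed
    ultimately show "\<exists>u. (\<forall>i<r. u i \<in> X) \<and> q = (\<lambda>j. \<Sum>i<r. u i j)"
      by (intro exI[of _ u]) auto
  qed
qed

section \<open>Extension of scalars and nonvanishing on Euclidean open sets\<close>

lemma poly_funs_complexify:
  assumes "f \<in> poly_funs A"
  shows "\<exists>F\<in>poly_funs A. \<forall>x. F (\<lambda>i. complex_of_real (x i)) = complex_of_real (f x)"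
  using assms
proof induction
  case (const c)
  show ?case by (rule bexI[of _ "\<lambda>_. complex_of_real c"]) (auto intro: poly_funs.const)
next
  case (coord a)
  then show ?case by (intro bexI[of _ "\<lambda>x. x a"]) (auto intro: poly_funs.coord)
next
  case (add f g)
  from add.IH(1) obtain F where "F \<in> poly_funs A"
    "\<forall>x. F (\<lambda>i. complex_of_real (x i)) = complex_of_real (f x)" by (rule bexE)
  moreover from add.IH(2) obtain G where "G \<in> poly_funs A"
    "\<forall>x. G (\<lambda>i. complex_of_real (x i)) = complex_of_real (g x)" by (rule bexE)
  ultimately show ?case by (intro bexI[of _ "\<lambda>x. F x + G x"] allI poly_funs.add) simp_all
next
  case (mult f g)
  from mult.IH(1) obtain F where "F \<in> poly_funs A"
    "\<forall>x. F (\<lambda>i. complex_of_real (x i)) = complex_of_real (f x)" by (rule bexE)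
  moreover from mult.IH(2) obtain G where "G \<in> poly_funs A"
    "\<forall>x. G (\<lambda>i. complex_of_real (x i)) = complex_of_real (g x)" by (rule bexE)
  ultimately show ?case by (intro bexI[of _ "\<lambda>x. F x * G x"] allI poly_funs.mult) simp_all
qed

text \<open>Real intervals are infinite sets of complex numbers, so the grid lemma applies to a cube
  inside \<open>U\<close>. Thus the real vectors of a Euclidean open set are Zariski dense in
  complex space.\<close>

lemma complex_poly_nonzero_on_real_open:
  fixes F :: "('n::finite \<Rightarrow> complex) \<Rightarrow> complex"
  assumes F: "F \<in> poly_funs UNIV" "F z \<noteq> 0" and U: "open U" "U \<noteq> {}"
  obtains v where "v \<in> U" "F (($) (complex_vec v)) \<noteq> 0"
proof -
  obtain a e where a: "e > 0" "ball a e \<subseteq> U" using U by (metis all_not_in_conv openE)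
  \<comment> \<open>With this half-side the cube lies in the ball, since the norm is at most the sum
    of the absolute values of the coordinates.\<close>
  define d where "d = e / real CARD('n)"
  have "d > 0" using a(1) by (simp add: d_def)
  then have inf: "infinite (complex_of_real ` {a $ i - d<..<a $ i + d})" for i
    by (simp add: finite_image_iff inj_on_def)
  obtain x where x: "\<forall>i. x i \<in> complex_of_real ` {a $ i - d<..<a $ i + d}" "F x \<noteq> 0"
    using poly_funs_nonzero_on_grid[where T = "\<lambda>i. complex_of_real ` {a $ i - d<..<a $ i + d}", OF F inf]
    by (elim exE conjE)
  define v where "v = (\<chi> i. Re (x i))"
  have close: "\<bar>(v - a) $ i\<bar> < d" for i using spec[OF x(1), of i] by (auto simp: v_def)
  have "norm (v - a) \<le> (\<Sum>i\<in>UNIV. \<bar>(v - a) $ i\<bar>)" by (rule norm_le_l1_cart)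
  also have "\<dots> < (\<Sum>i\<in>(UNIV :: 'n set). d)" by (rule sum_strict_mono) (use close in auto)
  also have "\<dots> = e" by (simp add: d_def)
  finally have "v \<in> U" using a(2) by (auto simp: dist_norm norm_minus_commute)
  moreover have "($) (complex_vec v) = x"
  proof
    show "complex_vec v $ i = x i" for i using spec[OF x(1), of i] by (auto simp: complex_vec_def v_def)
  qed
  ultimately show ?thesis using that x(2) by simp
qed

lemma real_poly_nonzero_on_open:
  fixes f :: "('n::finite \<Rightarrow> real) \<Rightarrow> real"
  assumes f: "f \<in> poly_funs UNIV" "f z \<noteq> 0" and U: "open U" "U \<noteq> {}"
  obtains v where "v \<in> U" "f (($) v) \<noteq> 0"
proof -
  obtain F where F: "F \<in> poly_funs UNIV" "\<And>x. F (\<lambda>i. complex_of_real (x i)) = complex_of_real (f x)"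
    using poly_funs_complexify[OF f(1)] by blast
  have "F (\<lambda>i. complex_of_real (z i)) \<noteq> 0" using f(2) F(2) by simp
  from complex_poly_nonzero_on_real_open[OF F(1) this U] obtain v where
    "v \<in> U" "F (($) (complex_vec v)) \<noteq> 0" .
  moreover have "($) (complex_vec v) = (\<lambda>i. complex_of_real (v $ i))"
    by (simp add: complex_vec_def fun_eq_iff)
  ultimately show ?thesis using that F(2) by simp
qed

lemma continuous_on_poly_funs:
  fixes f :: "('n::finite \<Rightarrow> real) \<Rightarrow> real"
  assumes "f \<in> poly_funs UNIV"
  shows "continuous_on S (\<lambda>v :: real ^ 'n. f (($) v))"
  using assms by induction (auto intro: continuous_intros)

lemma complex_vec_simps:
  "complex_vec 0 = 0" "complex_vec v = 0 \<longleftrightarrow> v = 0"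
  "complex_vec (c *s v) = complex_of_real c *s complex_vec v"
  "complex_vec (\<Sum>i\<in>I. x i) = (\<Sum>i\<in>I. complex_vec (x i))"
  by (simp_all add: complex_vec_def vec_eq_iff sum_component)

section \<open>Affine cones over projective zero sets\<close>

definition common_zeros :: "('a::field, 'n::finite) mpoly set \<Rightarrow> ('a ^ 'n) set" where
  "common_zeros E = {v. \<forall>p\<in>E. eval_mpoly p v = 0}"

lemma common_zeros_scale:
  "\<forall>p\<in>E. homogeneous p \<Longrightarrow> v \<in> common_zeros E \<Longrightarrow> c *s v \<in> common_zeros E"
  by (auto simp: common_zeros_def homogeneous_iff eval_mpoly_scale)

lemma proj_zeros_iff_common_zeros:
  assumes "\<forall>p\<in>E. homogeneous p" "v \<noteq> 0"
  shows "proj_point v \<in> proj_zeros E \<longleftrightarrow> v \<in> common_zeros E"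
proof
  assume "proj_point v \<in> proj_zeros E"
  then obtain w where w: "proj_point v = proj_point w" "w \<in> common_zeros E"
    by (auto simp: proj_zeros_def common_zeros_def)
  have "v \<in> proj_point v" unfolding proj_point_def by (rule range_eqI[of _ _ 1]) simp
  then obtain c where "v = c *s w" using w(1) by (auto simp: proj_point_def)
  then show "v \<in> common_zeros E" using common_zeros_scale[OF assms(1) w(2)] by simp
next
  assume "v \<in> common_zeros E"
  then show "proj_point v \<in> proj_zeros E"
    using assms(2) by (auto simp: proj_zeros_def common_zeros_def)
qed

text \<open>The assumption on \<open>0\<close> excludes nonzero constants among the equations: with
  such a constant there are no common zeros, but the cone contains \<open>0\<close> by
  definition.\<close>

lemma affine_cone_proj_zeros:
  assumes "\<forall>p\<in>E. homogeneous p" "0 \<in> common_zeros E"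
  shows "affine_cone (proj_zeros E) = common_zeros E"
proof
  show "affine_cone (proj_zeros E) \<subseteq> common_zeros E"
  proof
    fix v assume "v \<in> affine_cone (proj_zeros E)"
    then consider "v = 0" | w where "w \<in> common_zeros E" "v \<in> proj_point w"
      unfolding affine_cone_def by (auto simp: proj_zeros_def common_zeros_def)
    then show "v \<in> common_zeros E"
      by cases (use assms common_zeros_scale in \<open>auto simp: proj_point_def\<close>)
  qed
  show "common_zeros E \<subseteq> affine_cone (proj_zeros E)"
  proof
    fix v assume v: "v \<in> common_zeros E"
    have "v \<in> proj_point v" unfolding proj_point_def by (rule range_eqI[of _ _ 1]) simp
    then show "v \<in> affine_cone (proj_zeros E)"
      using proj_zeros_iff_common_zeros[OF assms(1), of v] v by (auto simp: affine_cone_def)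
  qed
qed

section \<open>Real and complex points of a variety\<close>

locale real_variety =
  fixes E :: "(real, 'n::finite) mpoly set"
  assumes homogeneous: "\<forall>p\<in>E. homogeneous p"
    and irreducible: "irreducible_variety E"
    and dense: "real_points_dense E"
begin

abbreviation "real_points \<equiv> common_zeros E"
abbreviation "complex_points \<equiv> common_zeros (of_real_mpoly ` E)"

lemma homogeneous_complex: "\<forall>p\<in>of_real_mpoly ` E. homogeneous p"
  by (rule homogeneous_of_real_mpoly_image[OF homogeneous])

lemma zero_in_complex_points: "0 \<in> complex_points"
proof -
  obtain z where "z \<in> complex_points"
    using irreducible by (auto simp: irreducible_variety_def complexification_def proj_zeros_def common_zeros_def)
  from common_zeros_scale[OF homogeneous_complex this, of 0] show ?thesis by simp
qed

lemma complex_vec_in_complex_points: "complex_vec v \<in> complex_points \<longleftrightarrow> v \<in> real_points"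
  by (simp add: common_zeros_def eval_of_real_mpoly_complex_vec)

lemma zero_in_real_points: "0 \<in> real_points"
  using complex_vec_in_complex_points[of 0] zero_in_complex_points by (simp add: complex_vec_simps)

lemma affine_real_points: "affine_cone (proj_zeros E) = real_points"
  by (rule affine_cone_proj_zeros[OF homogeneous zero_in_real_points])

lemma affine_complex_points: "affine_cone (complexification E) = complex_points"
  unfolding complexification_def
  by (rule affine_cone_proj_zeros[OF homogeneous_complex zero_in_complex_points])

lemma proj_point_in_complexification:
  assumes "\<forall>p\<in>G. homogeneous p" "z \<noteq> 0"
  shows "proj_point z \<in> complexification G \<longleftrightarrow> z \<in> common_zeros (of_real_mpoly ` G)"
  unfolding complexification_def
  by (rule proj_zeros_iff_common_zeros[OF homogeneous_of_real_mpoly_image[OF assms(1)] assms(2)])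

text \<open>The equation \<open>g = 0\<close> cuts out a set closed over the reals that contains the
  real points, hence also their closure, the complexification. The origin is treated apart because
  it is not a projective point.\<close>

lemma homogeneous_vanishing:
  assumes g: "homogeneous_of_degree d g" "\<And>v. v \<in> real_points \<Longrightarrow> eval_mpoly g v = 0"
    and z: "z \<in> complex_points"
  shows "eval_mpoly (of_real_mpoly g) z = 0"
proof (cases "z = 0")
  case True
  have "eval_mpoly (of_real_mpoly g) (complex_vec 0) = 0"
    using g(2)[OF zero_in_real_points] by (simp only: eval_of_real_mpoly_complex_vec of_real_0)
  with True show ?thesis by (simp add: complex_vec_simps)
next
  case False
  have hom: "\<forall>p\<in>{g}. homogeneous p" using g(1) by (auto simp: homogeneous_iff)
  let ?P = "{proj_point (complex_vec v) | v. v \<noteq> 0 \<and> proj_point v \<in> proj_zeros E}"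
  have "?P \<subseteq> complexification {g}"
  proof safe
    fix v :: "real ^ 'n" assume v: "v \<noteq> 0" "proj_point v \<in> proj_zeros E"
    then have "v \<in> real_points" using proj_zeros_iff_common_zeros[OF homogeneous] by blast
    then have "complex_vec v \<in> common_zeros (of_real_mpoly ` {g})"
      using g(2) by (simp add: common_zeros_def eval_of_real_mpoly_complex_vec)
    then show "proj_point (complex_vec v) \<in> complexification {g}"
      using proj_point_in_complexification[OF hom] v(1) by (simp add: complex_vec_simps)
  qed
  moreover have "real_zariski_closed (complexification {g})"
    using hom unfolding real_zariski_closed_def by blast
  ultimately have "real_zariski_closure ?P \<subseteq> complexification {g}"
    unfolding real_zariski_closure_def by blast
  then have "complexification E \<subseteq> complexification {g}"
    using dense by (simp add: real_points_dense_def)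
  moreover have "proj_point z \<in> complexification E"
    using proj_point_in_complexification[OF homogeneous False] z by blast
  ultimately have "z \<in> common_zeros (of_real_mpoly ` {g})"
    using proj_point_in_complexification[OF hom False] by blast
  then show ?thesis by (simp add: common_zeros_def)
qed

text \<open>Otherwise all coordinate functions would vanish on the real points, hence by density on
  the complex points, one of which is nonzero.\<close>

lemma nonzero_real_point: "\<exists>v\<in>real_points. v \<noteq> 0"
proof (rule ccontr)
  assume "\<not> ?thesis"
  then have zero: "v = 0" if "v \<in> real_points" for v using that by blast
  obtain z where z: "z \<in> complex_points" "z \<noteq> 0"
    using irreducible by (auto simp: irreducible_variety_def complexification_def proj_zeros_def common_zeros_def)
  have "z $ i = 0" for i
  proof -
    define g :: "(real, 'n) mpoly" where "g = Poly_Mapping.single (Poly_Mapping.single i 1) 1"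
    have "homogeneous_of_degree 1 g"
      by (simp add: homogeneous_of_degree_def g_def lookup_single when_def)
    moreover have "eval_mpoly g v = 0" if "v \<in> real_points" for v
      unfolding g_def eval_mpoly_coordinate using zero[OF that] by simp
    ultimately have "eval_mpoly (of_real_mpoly g) z = 0" using z(1) by (rule homogeneous_vanishing)
    moreover have "of_real_mpoly g = Poly_Mapping.single (Poly_Mapping.single i 1) 1"
      by (simp add: g_def)
    ultimately show ?thesis by (simp only: eval_mpoly_coordinate)
  qed
  with z(2) show False by (simp add: vec_eq_iff)
qed

text \<open>The real points form a cone, so scaling by real \<open>t\<close> shows that each
  homogeneous part of \<open>F\<close> vanishes on them. Splitting its coefficients into real and
  imaginary parts then makes density applicable.\<close>

lemma complex_poly_vanishing:
  fixes F :: "('n \<Rightarrow> complex) \<Rightarrow> complex"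
  assumes F: "F \<in> poly_funs UNIV" "\<And>v. v \<in> real_points \<Longrightarrow> F (($) (complex_vec v)) = 0"
    and z: "z \<in> complex_points"
  shows "F (($) z) = 0"
proof -
  obtain N p where p: "\<And>d. homogeneous_of_degree d (p d)"
    "\<And>x. F (($) x) = (\<Sum>d\<le>N. eval_mpoly (p d) x)"
    using poly_funs_homogeneous_parts[OF F(1)] by metis
  have "eval_mpoly (p d) z = 0" if "d \<le> N" for d
  proof -
    obtain a b where ab: "homogeneous_of_degree d a" "homogeneous_of_degree d b"
      "\<And>z. eval_mpoly (p d) z = eval_mpoly (of_real_mpoly a) z + \<i> * eval_mpoly (of_real_mpoly b) z"
      using eval_mpoly_Re_Im[OF p(1)] by metis
    have "eval_mpoly a v = 0 \<and> eval_mpoly b v = 0" if v: "v \<in> real_points" for v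
    proof -
      have "(\<Sum>d\<le>N. complex_of_real t ^ d * eval_mpoly (p d) (complex_vec v)) = 0" for t
        using F(2)[OF common_zeros_scale[OF homogeneous v, of t]]
        by (simp add: p(2) complex_vec_simps eval_mpoly_scale[OF p(1)])
      from polynomial_coeffs_zero[OF this \<open>d \<le> N\<close>] show ?thesis
        by (simp add: ab(3) eval_of_real_mpoly_complex_vec complex_eq_iff)
    qed
    then have "eval_mpoly (of_real_mpoly a) z = 0" "eval_mpoly (of_real_mpoly b) z = 0"
      using ab(1,2) z by (auto intro: homogeneous_vanishing)
    then show ?thesis by (simp add: ab(3))
  qed
  then show ?thesis by (simp add: p(2))
qed

text \<open>Irreducibility of the variety concerns projective points, so the witness must not be the
  origin. At the origin only a part of degree 0 can be nonzero, and being constant it is nonzero at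
  any other real point.\<close>

lemma homogeneous_part_nonzero:
  assumes p: "\<And>d. homogeneous_of_degree d (p d)" "(\<Sum>d\<le>N. eval_mpoly (p d) v) \<noteq> 0"
    and v: "v \<in> real_points"
  shows "\<exists>d\<le>N. \<exists>w\<in>real_points. w \<noteq> 0 \<and> eval_mpoly (p d) w \<noteq> 0"
proof -
  obtain d where d: "d \<le> N" "eval_mpoly (p d) v \<noteq> 0"
    using p(2) by (meson atMost_iff sum.neutral)
  show ?thesis
  proof (cases "v = 0")
    case True
    obtain w where w: "w \<in> real_points" "w \<noteq> 0" using nonzero_real_point by blast
    have scale: "eval_mpoly (p d) 0 = 0 ^ d * eval_mpoly (p d) w"
      using eval_mpoly_scale[OF p(1), of d 0 w] by simp
    then have "eval_mpoly (p d) w \<noteq> 0" using d(2) True by auto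
    with w d(1) show ?thesis by blast
  qed (use d v in blast)
qed

text \<open>If \<open>f * g\<close> vanished on the real points, it would vanish on the complex ones
  by density. The loci \<open>f = 0\<close> and \<open>g = 0\<close> would then cover the
  complexification, and irreducibility would make one of them everything, contrary to
  \<open>v\<close> or \<open>w\<close>.\<close>

lemma homogeneous_irreducible:
  assumes f: "homogeneous_of_degree d f" "v \<in> real_points" "v \<noteq> 0" "eval_mpoly f v \<noteq> 0"
    and g: "homogeneous_of_degree e g" "w \<in> real_points" "w \<noteq> 0" "eval_mpoly g w \<noteq> 0"
  shows "\<exists>x\<in>real_points. eval_mpoly f x \<noteq> 0 \<and> eval_mpoly g x \<noteq> 0"
proof (rule ccontr)
  assume "\<not> ?thesis"
  then have zero: "eval_mpoly (f * g) x = 0" if "x \<in> real_points" for x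
    using that by (auto simp: eval_mpoly_mult)
  have hom: "\<forall>p\<in>insert f E. homogeneous p" "\<forall>p\<in>insert g E. homogeneous p"
    using homogeneous f(1) g(1) by (auto simp: homogeneous_iff)
  have "complexification E = complexification (insert f E) \<union> complexification (insert g E)"
  proof
    show "complexification E \<subseteq> complexification (insert f E) \<union> complexification (insert g E)"
    proof
      fix l assume "l \<in> complexification E"
      then obtain z where z: "l = proj_point z" "z \<noteq> 0" "z \<in> complex_points"
        by (auto simp: complexification_def proj_zeros_def common_zeros_def)
      from homogeneous_vanishing[OF homogeneous_of_degree_mult[OF f(1) g(1)] zero z(3)]
      have "z \<in> common_zeros (of_real_mpoly ` insert f E) \<or> z \<in> common_zeros (of_real_mpoly ` insert g E)"
        using z(3) by (auto simp: of_real_mpoly_mult eval_mpoly_mult common_zeros_def)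
      then show "l \<in> complexification (insert f E) \<union> complexification (insert g E)"
        using proj_point_in_complexification[OF hom(1) z(2)] proj_point_in_complexification[OF hom(2) z(2)]
        by (auto simp: z(1))
    qed
  qed (auto simp: complexification_def proj_zeros_def)
  moreover have "real_zariski_closed (complexification (insert f E))"
    "real_zariski_closed (complexification (insert g E))"
    using hom unfolding real_zariski_closed_def by blast+
  ultimately have "complexification E = complexification (insert f E) \<or>
      complexification E = complexification (insert g E)"
    using irreducible unfolding irreducible_variety_def by blast
  moreover have False
    if "complexification E = complexification (insert h E)" "\<forall>p\<in>insert h E. homogeneous p"
      "u \<in> real_points" "u \<noteq> 0" "eval_mpoly h u \<noteq> 0" for h u
  proof -
    have u: "complex_vec u \<noteq> 0" using that(4) by (simp add: complex_vec_simps)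
    have "proj_point (complex_vec u) \<in> complexification E"
      using proj_point_in_complexification[OF homogeneous u] that(3) complex_vec_in_complex_points by blast
    then have "complex_vec u \<in> common_zeros (of_real_mpoly ` insert h E)"
      using proj_point_in_complexification[OF that(2) u] that(1) by blast
    then show False
      using that(5) by (simp add: common_zeros_def eval_of_real_mpoly_complex_vec)
  qed
  ultimately show False using f g hom by blast
qed

text \<open>Some homogeneous parts of \<open>f\<close> and \<open>g\<close> are both nonzero at one
  real point \<open>x\<close>. Along the multiples \<open>t *s x\<close>, \<open>f\<close> and
  \<open>g\<close> are then nonzero polynomials in \<open>t\<close>, and some \<open>t\<close> is a
  root of neither.\<close>

lemma irreducible_real_points: "zariski_irreducible ((\<lambda>v. ($) v) ` real_points)"
  unfolding zariski_irreducible_def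
proof (intro conjI ballI impI)
  show "(\<lambda>v. ($) v) ` real_points \<noteq> {}" using zero_in_real_points by blast
next
  fix f g :: "('n \<Rightarrow> real) \<Rightarrow> real" and x y
  assume fg: "f \<in> poly_funs UNIV" "g \<in> poly_funs UNIV"
    and xy: "x \<in> (\<lambda>v. ($) v) ` real_points" "y \<in> (\<lambda>v. ($) v) ` real_points" "f x \<noteq> 0" "g y \<noteq> 0"
  from xy obtain v w where v: "v \<in> real_points" "f (($) v) \<noteq> 0" and w: "w \<in> real_points" "g (($) w) \<noteq> 0"
    by auto
  obtain N p where p: "\<And>d. homogeneous_of_degree d (p d)"
    "\<And>x. f (($) x) = (\<Sum>d\<le>N. eval_mpoly (p d) x)"
    using poly_funs_homogeneous_parts[OF fg(1)] by metis
  obtain M q where q: "\<And>d. homogeneous_of_degree d (q d)"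
    "\<And>x. g (($) x) = (\<Sum>d\<le>M. eval_mpoly (q d) x)"
    using poly_funs_homogeneous_parts[OF fg(2)] by metis
  obtain d v' where d: "d \<le> N" "v' \<in> real_points" "v' \<noteq> 0" "eval_mpoly (p d) v' \<noteq> 0"
    using homogeneous_part_nonzero[of p, OF p(1) v(2)[unfolded p(2)] v(1)] by (elim exE conjE bexE)
  obtain e w' where e: "e \<le> M" "w' \<in> real_points" "w' \<noteq> 0" "eval_mpoly (q e) w' \<noteq> 0"
    using homogeneous_part_nonzero[of q, OF q(1) w(2)[unfolded q(2)] w(1)] by (elim exE conjE bexE)
  obtain x where x: "x \<in> real_points" "eval_mpoly (p d) x \<noteq> 0" "eval_mpoly (q e) x \<noteq> 0"
    using homogeneous_irreducible[OF p(1) d(2-4) q(1) e(2-4)] by blast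
  define P where "P = (\<Sum>d\<le>N. monom (eval_mpoly (p d) x) d)"
  define Q where "Q = (\<Sum>d\<le>M. monom (eval_mpoly (q d) x) d)"
  have "coeff P d \<noteq> 0" "coeff Q e \<noteq> 0" using d(1) e(1) x by (simp_all add: P_def Q_def coeff_sum)
  then have "P * Q \<noteq> 0" by auto
  then have "finite {t. poly (P * Q) t = 0}" by (rule poly_roots_finite)
  from ex_new_if_finite[OF infinite_UNIV_char_0 this] obtain t where
    "t \<notin> {t. poly (P * Q) t = 0}" by (elim exE)
  moreover have "f (($) (t *s x)) = poly P t" "g (($) (t *s x)) = poly Q t"
    by (simp_all add: p(2) q(2) P_def Q_def poly_sum poly_monom eval_mpoly_scale[OF p(1)]
        eval_mpoly_scale[OF q(1)] mult.commute)
  ultimately have "f (($) (t *s x)) \<noteq> 0 \<and> g (($) (t *s x)) \<noteq> 0" by simp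
  then show "\<exists>z\<in>(\<lambda>v. ($) v) ` real_points. f z \<noteq> 0 \<and> g z \<noteq> 0"
    using common_zeros_scale[OF homogeneous x(1), of t] by (intro bexI[of _ "($) (t *s x)"] imageI)
qed

lemma closed_real_points:
  "cylinder_closure UNIV ((\<lambda>v. ($) v) ` real_points) \<subseteq> (\<lambda>v. ($) v) ` real_points"
proof
  fix x assume x: "x \<in> cylinder_closure UNIV ((\<lambda>v. ($) v) ` real_points)"
  have "(\<chi> i. x i) \<in> real_points"
    unfolding common_zeros_def
  proof safe
    fix p assume "p \<in> E"
    have "(\<lambda>y. eval_mpoly p (\<chi> i. y i)) \<in> poly_funs UNIV"
      by (rule poly_funs_eval_mpoly) (simp add: poly_funs.coord)
    moreover have "\<forall>y\<in>(\<lambda>v. ($) v) ` real_points. eval_mpoly p (\<chi> i. y i) = 0"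
      using \<open>p \<in> E\<close> by (auto simp: common_zeros_def)
    ultimately show "eval_mpoly p (\<chi> i. x i) = 0"
      by (rule cylinder_closureD[OF x, of "\<lambda>y. eval_mpoly p (\<chi> i. y i)"])
  qed
  then show "x \<in> (\<lambda>v. ($) v) ` real_points" by (rule rev_image_eqI) (simp add: fun_eq_iff)
qed

section \<open>Sums of points of the cone and the comparison of ranks\<close>

definition real_sums :: "nat \<Rightarrow> (real ^ 'n) set" where
  "real_sums r = {v. \<exists>x. (\<forall>i<r. x i \<in> real_points) \<and> v = (\<Sum>i<r. x i)}"

lemma has_rank_real_iff:
  "has_rank (proj_zeros E) v r \<longleftrightarrow> v \<noteq> 0 \<and> v \<in> real_sums r \<and> (\<forall>s<r. v \<notin> real_sums s)"
  by (simp add: has_rank_def affine_real_points real_sums_def)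

lemma real_sums_mono: "s \<le> r \<Longrightarrow> real_sums s \<subseteq> real_sums r"
proof
  fix v assume "s \<le> r" "v \<in> real_sums s"
  then obtain x where x: "\<forall>i<s. x i \<in> real_points" "v = (\<Sum>i<s. x i)" by (auto simp: real_sums_def)
  have "v = (\<Sum>i<r. if i < s then x i else 0)"
    unfolding x(2) by (rule sum.mono_neutral_cong_left) (use \<open>s \<le> r\<close> in auto)
  then show "v \<in> real_sums r"
    unfolding real_sums_def using x(1) zero_in_real_points
    by (intro CollectI exI[of _ "\<lambda>i. if i < s then x i else 0"]) auto
qed

text \<open>The negation says that \<open>S\<close> is Zariski dense in the whole real
  space.\<close>

definition in_hypersurface :: "(real ^ 'n) set \<Rightarrow> bool" where
  "in_hypersurface S \<longleftrightarrow>
     (\<exists>f\<in>poly_funs UNIV. (\<exists>x. f x \<noteq> 0) \<and> (\<forall>v\<in>S. f (($) v) = 0))"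

lemma real_sums_contains_open:
  assumes "\<not> in_hypersurface (real_sums r)"
  obtains U where "open U" "U \<noteq> {}" "U \<subseteq> real_sums r"
proof -
  let ?X = "(\<lambda>v. ($) v) ` real_points"
  have sums: "(\<exists>u. (\<forall>i<r. u i \<in> ?X) \<and> y = (\<lambda>j. \<Sum>i<r. u i j)) \<longleftrightarrow> (\<chi> j. y j) \<in> real_sums r" for y
  proof
    assume "\<exists>u. (\<forall>i<r. u i \<in> ?X) \<and> y = (\<lambda>j. \<Sum>i<r. u i j)"
    then obtain u where u: "\<forall>i<r. u i \<in> ?X" "y = (\<lambda>j. \<Sum>i<r. u i j)" by blast
    then show "(\<chi> j. y j) \<in> real_sums r"
      unfolding real_sums_def
      by (intro CollectI exI[of _ "\<lambda>i. \<chi> j. u i j"]) (auto simp: vec_eq_iff sum_component)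
  next
    assume "(\<chi> j. y j) \<in> real_sums r"
    then obtain x where x: "\<forall>i<r. x i \<in> real_points" "(\<chi> j. y j) = (\<Sum>i<r. x i)"
      by (auto simp: real_sums_def)
    from x(2) have "y j = (\<Sum>i<r. x i $ j)" for j by (simp add: vec_eq_iff sum_component)
    then show "\<exists>u. (\<forall>i<r. u i \<in> ?X) \<and> y = (\<lambda>j. \<Sum>i<r. u i j)"
      using x(1) by (intro exI[of _ "\<lambda>i. ($) (x i)"]) auto
  qed
  have "\<forall>f\<in>poly_funs UNIV. (\<forall>u. (\<forall>i<r. u i \<in> ?X) \<longrightarrow> f (\<lambda>j. \<Sum>i<r. u i j) = 0) \<longrightarrow> (\<forall>x. f x = 0)"
  proof (intro ballI impI)
    fix f :: "('n \<Rightarrow> real) \<Rightarrow> real"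
    assume f: "f \<in> poly_funs UNIV" "\<forall>u. (\<forall>i<r. u i \<in> ?X) \<longrightarrow> f (\<lambda>j. \<Sum>i<r. u i j) = 0"
    have "f (($) v) = 0" if "v \<in> real_sums r" for v
    proof -
      have "\<exists>u. (\<forall>i<r. u i \<in> ?X) \<and> ($) v = (\<lambda>j. \<Sum>i<r. u i j)"
        unfolding sums using that by simp
      with f(2) show ?thesis by (elim exE conjE) simp
    qed
    then show "\<forall>x. f x = 0" using assms f(1) by (auto simp: in_hypersurface_def)
  qed
  from sums_contain_box[OF irreducible_real_points closed_real_points this] obtain p d where
    d: "d > 0" "\<And>q. \<forall>j. \<bar>q j - p j\<bar> < d \<Longrightarrow> (\<chi> j. q j) \<in> real_sums r"
    unfolding sums by blast
  show ?thesis
  proof (rule that)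
    show "ball (\<chi> j. p j) d \<subseteq> real_sums r"
    proof
      fix v assume "v \<in> ball (\<chi> j. p j) d"
      then have "norm (v - (\<chi> j. p j)) < d" by (simp add: dist_norm norm_minus_commute)
      then have "\<bar>v $ j - p j\<bar> < d" for j
        using component_le_norm_cart[of "v - (\<chi> j. p j)" j] by simp
      with d(2)[of "($) v"] show "v \<in> real_sums r" by simp
    qed
  qed (use d(1) in auto)
qed

lemma typical_rank_le:
  assumes "\<not> in_hypersurface (real_sums r)"
  shows "\<exists>s\<le>r. typical_rank (proj_zeros E) s"
proof -
  define s where "s = (LEAST s. \<not> in_hypersurface (real_sums s))"
  have s: "\<not> in_hypersurface (real_sums s)" unfolding s_def using assms by (rule LeastI)
  have "s \<le> r" unfolding s_def using assms by (rule Least_le)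
  \<comment> \<open>The only sum of no points is the origin, where every coordinate function
    vanishes; \<open>undefined\<close> is an arbitrary coordinate. Hence \<open>s\<close> has a
    predecessor.\<close>
  have "in_hypersurface (real_sums 0)"
    unfolding in_hypersurface_def
    by (rule bexI[of _ "\<lambda>x. x undefined"])
       (auto simp: real_sums_def poly_funs.coord intro: exI[of _ "\<lambda>_. 1"])
  with s obtain k where k: "s = Suc k" by (cases s) auto
  have "in_hypersurface (real_sums k)"
    using not_less_Least[of k "\<lambda>s. \<not> in_hypersurface (real_sums s)"] k by (simp add: s_def[symmetric])
  then obtain f a where f: "f \<in> poly_funs UNIV" "f a \<noteq> 0" "\<And>v. v \<in> real_sums k \<Longrightarrow> f (($) v) = 0"
    unfolding in_hypersurface_def by blast
  obtain U where U: "open U" "U \<noteq> {}" "U \<subseteq> real_sums s" using real_sums_contains_open[OF s] .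
  let ?W = "U \<inter> {v. f (($) v) \<noteq> 0}"
  have "open {v. f (($) v) \<noteq> 0}"
    using continuous_on_poly_funs[OF f(1)] by (intro open_Collect_neq continuous_on_const)
  then have "open ?W" using U(1) by blast
  moreover have "?W \<noteq> {}" using real_poly_nonzero_on_open[OF f(1,2) U(1,2)] by blast
  moreover have "has_rank (proj_zeros E) v s" if "v \<in> ?W" for v
    unfolding has_rank_real_iff
  proof (intro conjI allI impI)
    \<comment> \<open>Avoiding the hypersurface keeps \<open>v\<close> out of
      \<open>real_sums k\<close>, hence out of all shorter sums and away from the origin, the only
      element of \<open>real_sums 0\<close>.\<close>
    have v: "v \<notin> real_sums k" using that f(3) by auto
    then show "v \<notin> real_sums j" if "j < s" for j
      using real_sums_mono[of j k] that k by auto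
    from v real_sums_mono[of 0 k] show "v \<noteq> 0" by (auto simp: real_sums_def)
  qed (use that U(3) in auto)
  ultimately have "typical_rank (proj_zeros E) s"
    unfolding typical_rank_def by (intro exI[of _ ?W]) auto
  with \<open>s \<le> r\<close> show ?thesis by blast
qed

lemma complex_sums_vanishing:
  fixes F :: "('n \<Rightarrow> complex) \<Rightarrow> complex"
  assumes F: "F \<in> poly_funs UNIV" "\<And>v. v \<in> real_sums r \<Longrightarrow> F (($) (complex_vec v)) = 0"
    and z: "\<And>i. i < r \<Longrightarrow> z i \<in> complex_points"
  shows "F (($) (\<Sum>i<r. z i)) = 0"
proof -
  \<comment> \<open>The summands are moved from real to complex points one at a time.\<close>
  have "F (($) (\<Sum>i<r. z i)) = 0"
    if "k \<le> r" "\<And>i. i < k \<Longrightarrow> z i \<in> complex_points" "\<And>i. k \<le> i \<Longrightarrow> i < r \<Longrightarrow> z i \<in> complex_vec ` real_points"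
    for k z
    using that
  proof (induction k arbitrary: z)
    case 0
    then have "\<forall>i. \<exists>v. i < r \<longrightarrow> v \<in> real_points \<and> z i = complex_vec v" by blast
    then obtain x where x: "\<And>i. i < r \<Longrightarrow> x i \<in> real_points \<and> z i = complex_vec (x i)" by metis
    then have "(\<Sum>i<r. z i) = complex_vec (\<Sum>i<r. x i)" by (simp add: complex_vec_simps)
    moreover have "(\<Sum>i<r. x i) \<in> real_sums r" using x by (auto simp: real_sums_def)
    ultimately show ?case using F(2) by simp
  next
    case (Suc k)
    define y where "y = (\<Sum>i\<in>{..<r} - {k}. z i)"
    have y: "(\<Sum>i<r. (z(k := t)) i) = t + y" for t
    proof -
      have "(\<Sum>i<r. (z(k := t)) i) = t + (\<Sum>i\<in>{..<r} - {k}. (z(k := t)) i)"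
        using Suc.prems(1) by (subst sum.remove[of _ k]) auto
      also have "(\<Sum>i\<in>{..<r} - {k}. (z(k := t)) i) = y"
        unfolding y_def by (rule sum.cong) auto
      finally show ?thesis .
    qed
    \<comment> \<open>With the other summands fixed, \<open>F\<close> is a polynomial in the summand
      \<open>k\<close> alone. The induction hypothesis makes it vanish at real points, and density
      extends this to complex points.\<close>
    define G where "G = (\<lambda>x. F (\<lambda>j. x j + y $ j))"
    have "G \<in> poly_funs UNIV"
      unfolding G_def by (rule poly_funs_subst[OF F(1)]) (simp add: poly_funs.intros)
    moreover have G: "G (($) t) = F (($) (\<Sum>i<r. (z(k := t)) i))" for t
      unfolding y G_def by (simp add: plus_vec_def vec_lambda_inverse)
    have "G (($) (complex_vec v)) = 0" if "v \<in> real_points" for v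
      unfolding G
      by (rule Suc.IH) (use Suc.prems that in \<open>auto simp: Suc_le_eq\<close>)
    moreover have "z k \<in> complex_points" using Suc.prems by simp
    ultimately have "G (($) (z k)) = 0" by (rule complex_poly_vanishing)
    then show ?case unfolding G fun_upd_triv .
  qed
  from this[of r z] z show ?thesis by simp
qed

text \<open>The complexified equation would vanish on all sums of \<open>r\<close> complex points.
  Its nonvanishing locus is nonempty and Zariski open, so it would meet the open set of vectors of
  rank \<open>r\<close>, which are such sums.\<close>

lemma generic_rank_not_in_hypersurface:
  assumes "generic_rank (complexification E) r"
  shows "\<not> in_hypersurface (real_sums r)"
proof
  assume "in_hypersurface (real_sums r)"
  then obtain f a where f: "f \<in> poly_funs UNIV" "f a \<noteq> 0" "\<And>v. v \<in> real_sums r \<Longrightarrow> f (($) v) = 0"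
    unfolding in_hypersurface_def by blast
  obtain F where F: "F \<in> poly_funs UNIV" "\<And>x. F (\<lambda>i. complex_of_real (x i)) = complex_of_real (f x)"
    using poly_funs_complexify[OF f(1)] by blast
  have vanish: "F (($) (\<Sum>i<r. z i)) = 0" if "\<And>i. i < r \<Longrightarrow> z i \<in> complex_points" for z
  proof (rule complex_sums_vanishing[OF F(1) _ that])
    fix v assume "v \<in> real_sums r"
    moreover have "($) (complex_vec v) = (\<lambda>i. complex_of_real (v $ i))"
      by (simp add: complex_vec_def fun_eq_iff)
    ultimately show "F (($) (complex_vec v)) = 0" using F(2) f(3) by simp
  qed
  obtain q where q: "\<And>x. F (($) x) = eval_mpoly q x" using poly_funs_imp_eval_mpoly[OF F(1)] by blast
  obtain W where W: "zariski_open W" "W \<noteq> {}" "W \<subseteq> {v. has_rank (complexification E) v r}"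
    using assms by (auto simp: generic_rank_def)
  have "zariski_open {x. eval_mpoly q x \<noteq> 0}"
    unfolding zariski_open_def by (rule exI[of _ "{q}"]) simp
  moreover have "eval_mpoly q (complex_vec (\<chi> i. a i)) \<noteq> 0"
  proof -
    have "($) (complex_vec (\<chi> i. a i)) = (\<lambda>i. complex_of_real (a i))"
      by (simp add: complex_vec_def fun_eq_iff)
    then show ?thesis using F(2) f(2) by (simp flip: q)
  qed
  ultimately obtain v where v: "v \<in> W" "F (($) v) \<noteq> 0"
    using zariski_open_meet[OF W(1,2), of "{x. eval_mpoly q x \<noteq> 0}"] by (auto simp: q)
  then obtain z where "\<forall>i<r. z i \<in> complex_points" "v = (\<Sum>i<r. z i)"
    using W(3) by (auto simp: has_rank_def affine_complex_points)
  with vanish v(2) show False by blast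
qed

text \<open>Some real vector in \<open>U\<close> has its complexification in \<open>W\<close>. Its
  decomposition into \<open>s\<close> real points remains valid over the complex numbers, where
  fewer than \<open>r\<close> points do not suffice.\<close>

lemma generic_rank_le_typical_rank:
  assumes "generic_rank (complexification E) r" "typical_rank (proj_zeros E) s"
  shows "r \<le> s"
proof -
  obtain W where W: "zariski_open W" "W \<noteq> {}" "W \<subseteq> {v. has_rank (complexification E) v r}"
    using assms(1) by (auto simp: generic_rank_def)
  then obtain S where S: "W = {x. \<exists>p\<in>S. eval_mpoly p x \<noteq> 0}" by (auto simp: zariski_open_def)
  obtain p z where p: "p \<in> S" "eval_mpoly p z \<noteq> 0" using W(2) S by blast
  obtain U where U: "open U" "U \<noteq> {}" "U \<subseteq> {v. has_rank (proj_zeros E) v s}"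
    using assms(2) by (auto simp: typical_rank_def)
  have pf: "(\<lambda>y. eval_mpoly p (\<chi> i. y i)) \<in> poly_funs UNIV"
    by (rule poly_funs_eval_mpoly) (simp add: poly_funs.coord)
  have "eval_mpoly p (\<chi> i. z $ i) \<noteq> 0" using p(2) by simp
  from complex_poly_nonzero_on_real_open[OF pf this U(1,2)] obtain v where
    v: "v \<in> U" "eval_mpoly p (\<chi> i. complex_vec v $ i) \<noteq> 0" .
  then have "complex_vec v \<in> W" unfolding S using p(1) by auto
  then have rank: "has_rank (complexification E) (complex_vec v) r" using W(3) by blast
  from v(1) U(3) obtain x where x: "\<forall>i<s. x i \<in> real_points" "v = (\<Sum>i<s. x i)"
    by (auto simp: has_rank_def affine_real_points)
  have "\<forall>i<s. complex_vec (x i) \<in> complex_points" using x(1) complex_vec_in_complex_points by blast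
  moreover have "complex_vec v = (\<Sum>i<s. complex_vec (x i))" by (simp add: x(2) complex_vec_simps)
  ultimately have "\<exists>y. (\<forall>i<s. y i \<in> complex_points) \<and> complex_vec v = (\<Sum>i<s. y i)"
    by (intro exI[of _ "\<lambda>i. complex_vec (x i)"] conjI)
  moreover have "\<forall>s<r. \<not> (\<exists>y. (\<forall>i<s. y i \<in> complex_points) \<and> complex_vec v = (\<Sum>i<s. y i))"
    using rank unfolding has_rank_def affine_complex_points by (elim conjE)
  ultimately show ?thesis using not_le_imp_less by blast
qed

end

theorem theorem2:
  fixes E :: "(real, 'n::finite) mpoly set" and r0 r_gen :: nat
  assumes "\<forall>p\<in>E. homogeneous p"
    and "irreducible_variety E"
    and "nondegenerate E"
    and "real_points_dense E"
    and "min_typical_rank (proj_zeros E) r0"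
    and "generic_rank (complexification E) r_gen"
  shows "r0 = r_gen"
proof (rule antisym)
  interpret real_variety E using assms(1,2,4) by unfold_locales
  show "r_gen \<le> r0"
    using generic_rank_le_typical_rank[OF assms(6)] assms(5) by (simp add: min_typical_rank_def)
  obtain s where "s \<le> r_gen" "typical_rank (proj_zeros E) s"
    using typical_rank_le[OF generic_rank_not_in_hypersurface[OF assms(6)]] by blast
  then show "r0 \<le> r_gen"
    using assms(5) unfolding min_typical_rank_def by (meson order_trans)
qed

end
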